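(* Let $\Bbbk$ be a field, $S=\Bbbk[x_1,\dots,x_n]$, let $I \subsetneq S$ be a squarefree monomial ideal with minimal free resolution $\mathbb{F}$ of $S/I$, and let $*$ be a multiplication on $\mathbb{F}$. Then, for $V, W \in \Delta_I$ with $V \cup W \in \Delta_I$, it holds that $$\mathbf{g}_W * \mathbf{g}_V = \begin{cases} (-1)^{\sigma(W,V)} \dfrac{m_W m_V}{m_{W \cup V}}\, \mathbf{g}_{W \cup V} & \text{if } W \cap V = \emptyset, \\ 0 & \text{otherwise.} \end{cases}$$ In particular, the product $\mathbf{g}_W * \mathbf{g}_V$ does not depend on the choice of $*$.
   Context: $S$ carries the fine $\mathbb{Z}^n$-grading. Let $\mathbb{F}$ be the minimal $\mathbb{Z}^n$-graded free resolution of $S/I$ with $\mathbb{F}_0=S$ and differential $\partial$, identified with $\bigoplus_i\mathbb{F}_i$; $|f|$ denotes the homological degree. A multiplication on $\mathbb{F}$ is an $S$-linear map $*:\mathbb{F}\otimes_S\mathbb{F}\to\mathbb{F}$ respecting the $\mathbb{Z}^n$-grading (not necessarily associative), such that for all (homogeneous) $a,b$: (1) $*$ extends the usual multiplication on $\mathbb{F}_0=S$ and $1\in\mathbb{F}_0$ acts as the identity; (2) $\partial(a*b)=\partial(a)*b+(-1)^{|a|}a*\partial(b)$; (3) $|a*b|=|a|+|b|$; (4) $a*b=(-1)^{|a||b|}b*a$. Let $G(I)$ be the set of minimal monomial generators of $I$, with a fixed total order $\prec$. For $W\subseteq G(I)$ put $m_W:=\operatorname{lcm}(m: m\in W)$.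 For $W,V\subseteq G(I)$ put $\sigma(W,V):=\#\{(m,m')\in W\times V : m'\prec m\}$, and for $m\in W$ put $\sigma(m,W):=\#\{m'\in W: m'\prec m\}$. The Taylor resolution $\mathbb{T}$ of $S/I$ is the complex of free $S$-modules with basis $\{\mathbf{g}_W: W\subseteq G(I)\}$, $|\mathbf{g}_W|=\#W$, $\deg\mathbf{g}_W=\deg m_W$, and differential $\partial\mathbf{g}_W=\sum_{m\in W}(-1)^{\sigma(m,W)}\frac{m_W}{m_{W\setminus\{m\}}}\mathbf{g}_{W\setminus\{m\}}$. The Scarf complex $\Delta_I$ is the simplicial complex of those $W\subseteq G(I)$ for which there is no $V\subseteq G(I)$, $V\ne W$, with $m_V=m_W$. The algebraic Scarf complex is the subcomplex of $\mathbb{T}$ generated by the $\mathbf{g}_W$, $W\in\Delta_I$; it is always (isomorphic to) a subcomplex of the minimal free resolution $\mathbb{F}$, its basis being part of a basis of $\mathbb{F}$, and for $W\in\Delta_I$ the corresponding element of $\mathbb{F}$ is again denoted $\mathbf{g}_W$ (with $\mathbf{g}_\emptyset = 1$). *)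

theory Defs
  imports Complex_Main "HOL-Library.Poly_Mapping"
begin

text \<open>
  Variables are indexed by a finite type \<open>'n\<close>. A monomial is identified with its exponent vector;
  the polynomial ring \<open>S\<close> is the monoid algebra of exponent vectors over the field \<open>'k\<close>.
\<close>

type_synonym 'n expo = "'n \<Rightarrow>\<^sub>0 nat"
type_synonym ('n, 'k) pring = "'n expo \<Rightarrow>\<^sub>0 'k"

definition xmon :: "'n::finite expo \<Rightarrow> ('n, 'k::field) pring" where
  "xmon m = Poly_Mapping.single m 1"

text \<open>The degree of a monomial in the fine grading group \<open>'n \<Rightarrow>\<^sub>0 int\<close>, that is, \<open>\<int>\<^sup>n\<close>.\<close>

definition mdeg :: "'n::finite expo \<Rightarrow> ('n \<Rightarrow>\<^sub>0 int)" where
  "mdeg m = Poly_Mapping.map int m"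

text \<open>Ideals of \<open>S\<close> are the submodules of \<open>S\<close> acting on itself by multiplication.\<close>

abbreviation ideal_gen :: "('n::finite, 'k::field) pring set \<Rightarrow> ('n, 'k) pring set" where
  "ideal_gen A \<equiv> module.span (*) A"

definition squarefree_monomial_ideal :: "('n::finite, 'k::field) pring set \<Rightarrow> bool" where
  "squarefree_monomial_ideal I \<longleftrightarrow>
     (\<exists>A. (\<forall>m\<in>A. \<forall>i. Poly_Mapping.lookup m i \<le> 1) \<and> I = ideal_gen (xmon ` A))"

definition minimal_monomial_generators ::
    "('n::finite, 'k::field) pring set \<Rightarrow> 'n expo set \<Rightarrow> bool" where
  "minimal_monomial_generators I G \<longleftrightarrow>
     ideal_gen (xmon ` G) = I \<and> (\<forall>G'. G' \<subset> G \<longrightarrow> ideal_gen (xmon ` G') \<noteq> I)"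

text \<open>
  The least common multiple, for finite \<open>W\<close>: the supremum of the exponents, where
  \<open>Sup {} = 0\<close> on \<open>nat\<close>, so that the lcm of the empty set is the monomial 1.
\<close>

definition lcm_mon :: "'n::finite expo set \<Rightarrow> 'n expo" where
  "lcm_mon W = Abs_poly_mapping (\<lambda>i. SUP m\<in>W. Poly_Mapping.lookup m i)"

text \<open>
  A strict order \<open>\<prec>\<close> is a relation \<open>r\<close> with \<open>(m', m) \<in> r\<close> meaning \<open>m' \<prec> m\<close>.
\<close>

definition sigma :: "'a rel \<Rightarrow> 'a set \<Rightarrow> 'a set \<Rightarrow> nat" where
  "sigma r W V = card {(m, m'). m \<in> W \<and> m' \<in> V \<and> (m', m) \<in> r}"

definition sigma1 :: "'a rel \<Rightarrow> 'a \<Rightarrow> 'a set \<Rightarrow> nat" where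
  "sigma1 r m W = card {m' \<in> W. (m', m) \<in> r}"

text \<open>
  The Taylor resolution. The basis element \<open>g\<^sub>W\<close> is \<open>taylor_basis W\<close>, and an element \<open>t\<close> of the
  free module has coefficient \<open>lookup t W\<close> at \<open>g\<^sub>W\<close>. The type contains a basis element for
  every set of monomials; the Taylor resolution itself is the part supported on subsets
  of \<open>G(I)\<close>. Subtraction of exponent vectors is truncated, but here and below it is only
  applied to a monomial and one of its divisors.
\<close>

type_synonym ('n, 'k) taylor = "'n expo set \<Rightarrow>\<^sub>0 ('n, 'k) pring"

definition taylor_basis :: "'n::finite expo set \<Rightarrow> ('n, 'k::field) taylor" where
  "taylor_basis W = Poly_Mapping.single W 1"

definition taylor_scale ::
    "('n::finite, 'k::field) pring \<Rightarrow> ('n, 'k) taylor \<Rightarrow> ('n, 'k) taylor" where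
  "taylor_scale s t = Poly_Mapping.map ((*) s) t"

definition taylor_diff ::
    "'n::finite expo rel \<Rightarrow> ('n, 'k::field) taylor \<Rightarrow> ('n, 'k) taylor" where
  "taylor_diff r t =
     (\<Sum>W\<in>Poly_Mapping.keys t. taylor_scale (Poly_Mapping.lookup t W)
        (\<Sum>m\<in>W. taylor_scale ((-1) ^ sigma1 r m W * xmon (lcm_mon W - lcm_mon (W - {m})))
                (taylor_basis (W - {m}))))"

definition scarf :: "'n::finite expo set \<Rightarrow> 'n expo set set" where
  "scarf G = {W. W \<subseteq> G \<and> \<not> (\<exists>V. V \<subseteq> G \<and> V \<noteq> W \<and> lcm_mon V = lcm_mon W)}"

definition algebraic_scarf :: "'n::finite expo set \<Rightarrow> ('n, 'k::field) taylor set" where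
  "algebraic_scarf G = {t. Poly_Mapping.keys t \<subseteq> scarf G}"

text \<open>The type \<open>'f\<close> is the internal direct sum of the family \<open>C\<close> of subgroups.\<close>

definition internal_direct_sum :: "('i \<Rightarrow> 'f::ab_group_add set) \<Rightarrow> bool" where
  "internal_direct_sum C \<longleftrightarrow>
     (\<forall>i. 0 \<in> C i \<and> (\<forall>x\<in>C i. \<forall>y\<in>C i. x - y \<in> C i)) \<and>
     (\<forall>x. \<exists>!f. finite {i. f i \<noteq> 0} \<and> (\<forall>i. f i \<in> C i) \<and> x = sum f {i. f i \<noteq> 0})"

text \<open>
  The underlying module of a resolution \<open>F\<close> is the whole type \<open>'f\<close>, with scalar multiplication
  \<open>scale\<close>. \<open>H i\<close> is the component \<open>F\<^sub>i\<close> of homological degree \<open>i\<close>, \<open>D a\<close> the component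
  of multidegree \<open>a\<close>, \<open>d\<close> the differential, and \<open>one\<close> the element 1 of \<open>F\<^sub>0 = S\<close>.
\<close>

definition multigraded_module ::
    "(('n::finite, 'k::field) pring \<Rightarrow> 'f \<Rightarrow> 'f) \<Rightarrow> (('n \<Rightarrow>\<^sub>0 int) \<Rightarrow> 'f::ab_group_add set) \<Rightarrow> bool" where
  "multigraded_module scale D \<longleftrightarrow>
     module scale \<and> internal_direct_sum D \<and>
     (\<forall>a m c. \<forall>x\<in>D a. scale (Poly_Mapping.single m c) x \<in> D (a + mdeg m))"

definition is_basis ::
    "(('n::finite, 'k::field) pring \<Rightarrow> 'f \<Rightarrow> 'f) \<Rightarrow> 'f::ab_group_add set \<Rightarrow> 'f set \<Rightarrow> bool" where
  "is_basis scale X B \<longleftrightarrow> \<not> module.dependent scale B \<and> module.span scale B = X"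

definition graded_free_complex ::
    "(('n::finite, 'k::field) pring \<Rightarrow> 'f \<Rightarrow> 'f) \<Rightarrow> (nat \<Rightarrow> 'f set) \<Rightarrow>
     (('n \<Rightarrow>\<^sub>0 int) \<Rightarrow> 'f::ab_group_add set) \<Rightarrow> ('f \<Rightarrow> 'f) \<Rightarrow> bool" where
  "graded_free_complex scale H D d \<longleftrightarrow>
     multigraded_module scale D \<and>
     internal_direct_sum H \<and>
     (\<forall>i. \<exists>B. finite B \<and> B \<subseteq> (\<Union>a. D a) \<and> is_basis scale (H i) B) \<and>
     module_hom scale scale d \<and>
     (\<forall>a. d ` D a \<subseteq> D a) \<and>
     d ` H 0 = {0} \<and> (\<forall>i. d ` H (Suc i) \<subseteq> H i) \<and>
     (\<forall>x. d (d x) = 0)"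

definition minimal_complex ::
    "(('n::finite, 'k::field) pring \<Rightarrow> 'f \<Rightarrow> 'f) \<Rightarrow> ('f::ab_group_add \<Rightarrow> 'f) \<Rightarrow> bool" where
  "minimal_complex scale d \<longleftrightarrow>
     range d \<subseteq> module.span scale {scale (xmon (Poly_Mapping.single i 1)) y | i y. True}"

definition minimal_free_resolution ::
    "('n::finite, 'k::field) pring set \<Rightarrow> (('n, 'k) pring \<Rightarrow> 'f \<Rightarrow> 'f) \<Rightarrow> (nat \<Rightarrow> 'f set) \<Rightarrow>
     (('n \<Rightarrow>\<^sub>0 int) \<Rightarrow> 'f::ab_group_add set) \<Rightarrow> ('f \<Rightarrow> 'f) \<Rightarrow> 'f \<Rightarrow> bool" where
  "minimal_free_resolution I scale H D d one \<longleftrightarrow>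
     graded_free_complex scale H D d \<and>
     one \<in> D 0 \<and> bij_betw (\<lambda>s. scale s one) UNIV (H 0) \<and>
     {s. scale s one \<in> d ` H 1} = I \<and>
     (\<forall>i. {x \<in> H (Suc i). d x = 0} = d ` H (Suc (Suc i))) \<and>
     minimal_complex scale d"

text \<open>
  An \<open>S\<close>-linear map on the tensor square of \<open>F\<close> is given as an \<open>S\<close>-bilinear map.
\<close>

definition multiplication ::
    "(('n::finite, 'k::field) pring \<Rightarrow> 'f \<Rightarrow> 'f) \<Rightarrow> (nat \<Rightarrow> 'f set) \<Rightarrow>
     (('n \<Rightarrow>\<^sub>0 int) \<Rightarrow> 'f::ab_group_add set) \<Rightarrow> ('f \<Rightarrow> 'f) \<Rightarrow> 'f \<Rightarrow> ('f \<Rightarrow> 'f \<Rightarrow> 'f) \<Rightarrow> bool" where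
  "multiplication scale H D d one mult \<longleftrightarrow>
     (\<forall>x. module_hom scale scale (\<lambda>y. mult x y)) \<and>
     (\<forall>y. module_hom scale scale (\<lambda>x. mult x y)) \<and>
     (\<forall>a b. \<forall>x\<in>D a. \<forall>y\<in>D b. mult x y \<in> D (a + b)) \<and>
     (\<forall>s t. mult (scale s one) (scale t one) = scale (s * t) one) \<and>
     (\<forall>x. mult one x = x \<and> mult x one = x) \<and>
     (\<forall>i j. \<forall>x\<in>H i. \<forall>y\<in>H j.
        d (mult x y) = mult (d x) y + scale ((-1) ^ i) (mult x (d y)) \<and>
        mult x y \<in> H (i + j) \<and>
        mult x y = scale ((-1) ^ (i * j)) (mult y x))"

text \<open>
  \<open>\<phi>\<close> identifies the algebraic Scarf complex with a subcomplex of the resolution, its basis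
  being part of a homogeneous basis. The values of \<open>\<phi>\<close> outside the algebraic Scarf complex
  are irrelevant.
\<close>

definition scarf_embedding ::
    "'n::finite expo set \<Rightarrow> 'n expo rel \<Rightarrow>
     (('n, 'k::field) pring \<Rightarrow> 'f \<Rightarrow> 'f) \<Rightarrow> (nat \<Rightarrow> 'f set) \<Rightarrow>
     (('n \<Rightarrow>\<^sub>0 int) \<Rightarrow> 'f::ab_group_add set) \<Rightarrow> ('f \<Rightarrow> 'f) \<Rightarrow> 'f \<Rightarrow>
     (('n, 'k) taylor \<Rightarrow> 'f) \<Rightarrow> bool" where
  "scarf_embedding G r scale H D d one \<phi> \<longleftrightarrow>
     (\<forall>t\<in>algebraic_scarf G. \<forall>u\<in>algebraic_scarf G. \<phi> (t + u) = \<phi> t + \<phi> u) \<and>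
     (\<forall>s. \<forall>t\<in>algebraic_scarf G. \<phi> (taylor_scale s t) = scale s (\<phi> t)) \<and>
     inj_on \<phi> (algebraic_scarf G) \<and>
     (\<forall>t\<in>algebraic_scarf G. \<phi> (taylor_diff r t) = d (\<phi> t)) \<and>
     (\<forall>W\<in>scarf G. \<phi> (taylor_basis W) \<in> H (card W) \<inter> D (mdeg (lcm_mon W))) \<and>
     (\<exists>B. is_basis scale UNIV B \<and> B \<subseteq> (\<Union>i. \<Union>a. H i \<inter> D a) \<and>
          (\<phi> \<circ> taylor_basis) ` scarf G \<subseteq> B) \<and>
     \<phi> (taylor_basis {}) = one"

end

theory Submission
  imports Defs
begin

text \<open>
  Why the products are determined: let \<open>U = W \<union> V\<close>. The product of \<open>g\<^sub>W\<close> and \<open>g\<^sub>V\<close> has the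
  multidegree of \<open>m\<^sub>W m\<^sub>V\<close>, a monomial in the variables that occur in \<open>m\<^sub>U\<close>, and homological
  degree \<open>|W| + |V| \<ge> |U|\<close>. In the multidegrees supported on the variables of \<open>m\<^sub>U\<close>, a minimal
  resolution of a squarefree ideal is nothing but the simplex \<open>U\<close>: every element of homological
  degree \<open>i\<close> is a combination of the \<open>g\<^sub>X\<close> with \<open>X \<subseteq> U\<close> and \<open>|X| = i\<close>
  (\<open>below_scarf_simplex\<close>). So there is nothing above homological degree \<open>|U|\<close>. If \<open>W\<close> and \<open>V\<close>
  meet, then \<open>|W| + |V| > |U|\<close> and the product is 0. If they are disjoint and not both empty, then
  there are no nonzero boundaries in the bidegree of the product, so by exactness the differential
  is injective there, and it suffices to compare the boundaries of the two sides of the claim. That is the Leibniz rule,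
  induction on \<open>|W| + |V|\<close> and a computation of signs (\<open>mult_g\<close>).

  The description of the resolution below \<open>U\<close> is proved by induction on the homological degree.
  For \<open>x\<close> of positive homological degree, \<open>d x\<close> is by induction a cycle among the chains on \<open>U\<close>.
  Those of a fixed multidegree \<open>a\<close> form the chain complex of the full simplex on the
  \<open>v \<in> U\<close> dividing \<open>x\<^sup>a\<close>, which is acyclic by a cone construction once such a \<open>v\<close> exists. The
  existence of \<open>v\<close> is only in question if \<open>d x\<close> is a nonzero element of \<open>S\<close>. In that case \<open>x\<^sup>a \<in> I\<close>
  is divisible by a generator of \<open>I\<close>; as a squarefree monomial in the variables of \<open>m\<^sub>U\<close> this
  generator divides \<open>m\<^sub>U\<close>, and the Scarf condition puts it into \<open>U\<close>. Hence \<open>d x = d y\<close> for a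
  chain \<open>y\<close> on \<open>U\<close>, and \<open>x - y\<close> is a boundary. By minimality boundaries lie in
  \<open>(x\<^sub>1, \<dots>, x\<^sub>n) F\<close>, so a graded Nakayama argument finishes the proof.
\<close>

section \<open>Components of internal direct sums\<close>

definition component :: "('i \<Rightarrow> 'f::ab_group_add set) \<Rightarrow> 'i \<Rightarrow> 'f \<Rightarrow> 'f" where
  "component C i x =
     (THE f. finite {j. f j \<noteq> 0} \<and> (\<forall>j. f j \<in> C j) \<and> x = sum f {j. f j \<noteq> 0}) i"

lemma direct_sum_zero: "internal_direct_sum C \<Longrightarrow> 0 \<in> C i"
  by (auto simp: internal_direct_sum_def)

lemma direct_sum_diff: "internal_direct_sum C \<Longrightarrow> x \<in> C i \<Longrightarrow> y \<in> C i \<Longrightarrow> x - y \<in> C i"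
  by (auto simp: internal_direct_sum_def)

lemma direct_sum_add:
  assumes "internal_direct_sum C" "x \<in> C i" "y \<in> C i"
  shows "x + y \<in> C i"
proof -
  have "x - (0 - y) \<in> C i"
    by (intro direct_sum_diff[OF assms(1)] direct_sum_zero[OF assms(1)] assms)
  then show ?thesis by simp
qed

lemma direct_sum_sum:
  assumes "internal_direct_sum C" "\<And>j. j \<in> J \<Longrightarrow> f j \<in> C i"
  shows "sum f J \<in> C i"
  using assms(2)
  by (induction J rule: infinite_finite_induct)
     (auto intro: direct_sum_zero[OF assms(1)] direct_sum_add[OF assms(1)])

lemma component_unique:
  assumes "internal_direct_sum C" "finite {j. f j \<noteq> 0}" "\<And>j. f j \<in> C j"
    "x = sum f {j. f j \<noteq> 0}"
  shows "component C i x = f i"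
proof -
  have "\<exists>!f. finite {j. f j \<noteq> 0} \<and> (\<forall>j. f j \<in> C j) \<and> x = sum f {j. f j \<noteq> 0}"
    using assms(1) unfolding internal_direct_sum_def by blast
  then have "(THE f. finite {j. f j \<noteq> 0} \<and> (\<forall>j. f j \<in> C j) \<and> x = sum f {j. f j \<noteq> 0}) = f"
    using assms(2-4) by (intro the1_equality) auto
  then show ?thesis by (simp add: component_def)
qed

lemma component_decomposition:
  assumes "internal_direct_sum C"
  shows "finite {j. component C j x \<noteq> 0}" "component C i x \<in> C i"
    "x = (\<Sum>j | component C j x \<noteq> 0. component C j x)"
proof -
  let ?P = "\<lambda>f. finite {j. f j \<noteq> 0} \<and> (\<forall>j. f j \<in> C j) \<and> x = sum f {j. f j \<noteq> 0}"
  have "\<exists>!f. ?P f"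
    using assms unfolding internal_direct_sum_def by blast
  from theI'[OF this] have "?P (\<lambda>j. component C j x)"
    unfolding component_def by simp
  then show "finite {j. component C j x \<noteq> 0}" "component C i x \<in> C i"
    "x = (\<Sum>j | component C j x \<noteq> 0. component C j x)"
    by auto
qed

lemma component_mem:
  assumes "internal_direct_sum C" "x \<in> C j"
  shows "component C i x = (if i = j then x else 0)"
proof (cases "x = 0")
  case True
  then show ?thesis
    using component_unique[of C "\<lambda>_. 0" x i] assms direct_sum_zero[of C] by auto
next
  case False
  then have *: "{k. (if k = j then x else 0) \<noteq> 0} = {j}" by auto
  show ?thesis
    by (rule component_unique[OF assms(1), where f = "\<lambda>i. if i = j then x else 0"])
       (use assms * direct_sum_zero[of C] in auto)
qed

lemma component_add:
  assumes C: "internal_direct_sum C"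
  shows "component C i (x + y) = component C i x + component C i y"
proof -
  let ?f = "\<lambda>i. component C i x" and ?g = "\<lambda>i. component C i y"
  note fx = component_decomposition[OF C, where x = x] and fy = component_decomposition[OF C, where x = y]
  define J where "J = {j. ?f j \<noteq> 0} \<union> {j. ?g j \<noteq> 0}"
  have J: "finite J" using fx(1) fy(1) by (simp add: J_def)
  have sub: "{j. ?f j + ?g j \<noteq> 0} \<subseteq> J" by (auto simp: J_def)
  have "x = sum ?f J"
    using J by (subst fx(3)) (rule sum.mono_neutral_left, auto simp: J_def)
  moreover have "y = sum ?g J"
    using J by (subst fy(3)) (rule sum.mono_neutral_left, auto simp: J_def)
  ultimately have "x + y = (\<Sum>j\<in>J. ?f j + ?g j)"
    by (simp add: sum.distrib)
  also have "\<dots> = (\<Sum>j | ?f j + ?g j \<noteq> 0. ?f j + ?g j)"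
    using J sub by (intro sum.mono_neutral_right) auto
  finally show ?thesis
    using finite_subset[OF sub J] fx(2) fy(2)
    by (intro component_unique[OF C]) (auto intro: direct_sum_add[OF C])
qed

lemma component_zero: "internal_direct_sum C \<Longrightarrow> component C i 0 = 0"
  using component_mem[of C 0 i i] direct_sum_zero[of C] by auto

lemma component_sum:
  assumes "internal_direct_sum C"
  shows "component C i (sum f J) = (\<Sum>j\<in>J. component C i (f j))"
  by (induction J rule: infinite_finite_induct)
     (auto simp: component_zero[OF assms] component_add[OF assms])

text \<open>
  Additive maps that send summands into summands, distinct ones into distinct ones, commute with
  taking components. The cases
  of interest are the differential, the multiplication by a monomial (which shifts the
  multidegree), and, for the homological grading, the multiplication by any scalar.
\<close>

lemma component_commute:
  assumes C: "internal_direct_sum C" and h: "\<And>x y. h (x + y) = h x + h y"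
    and hC: "\<And>j x. x \<in> C j \<Longrightarrow> h x \<in> C (s j)" and s: "inj s"
  shows "component C (s i) (h x) = h (component C i x)"
proof -
  note dec = component_decomposition[OF C, where x = x]
  have h0: "h 0 = 0" using h[of 0 0] by simp
  have hsum: "h (sum f J) = (\<Sum>j\<in>J. h (f j))" for f :: "'c \<Rightarrow> 'b" and J
    by (induction J rule: infinite_finite_induct) (auto simp: h h0)
  let ?J = "{j. component C j x \<noteq> 0}"
  have "component C (s i) (h x) = (\<Sum>j\<in>?J. component C (s i) (h (component C j x)))"
    by (subst dec(3)) (simp add: hsum component_sum[OF C])
  also have "\<dots> = (\<Sum>j\<in>?J. if i = j then h (component C j x) else 0)"
    by (intro sum.cong refl)
       (auto simp: component_mem[OF C hC[OF dec(2)]] dest: injD[OF s])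
  also have "\<dots> = h (component C i x)"
    using dec(1) h0 by (auto simp: sum.delta)
  finally show ?thesis .
qed

section \<open>Monomials and their multidegrees\<close>

definition divides :: "('n::finite) expo \<Rightarrow> 'n expo \<Rightarrow> bool" where
  "divides m m' \<longleftrightarrow> (\<forall>i. Poly_Mapping.lookup m i \<le> Poly_Mapping.lookup m' i)"

definition effective :: "('n::finite \<Rightarrow>\<^sub>0 int) \<Rightarrow> bool" where
  "effective a \<longleftrightarrow> (\<forall>i. 0 \<le> Poly_Mapping.lookup a i)"

definition total_degree :: "('n::finite \<Rightarrow>\<^sub>0 int) \<Rightarrow> int" where
  "total_degree a = (\<Sum>i\<in>UNIV. Poly_Mapping.lookup a i)"

lemma lookup_mdeg [simp]: "Poly_Mapping.lookup (mdeg m) i = int (Poly_Mapping.lookup m i)"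
  by (simp add: mdeg_def Poly_Mapping.map.rep_eq when_def)

lemma mdeg_add: "mdeg (m + m') = mdeg m + mdeg m'"
  by (rule poly_mapping_eqI) (simp add: lookup_add)

lemma mdeg_zero [simp]: "mdeg 0 = 0"
  by (rule poly_mapping_eqI) simp

lemma inj_mdeg: "inj mdeg"
  by (rule injI) (metis lookup_mdeg of_nat_eq_iff poly_mapping_eqI)

lemma effective_mdeg [simp]: "effective (mdeg m)"
  by (simp add: effective_def)

lemma effective_iff_mdeg: "effective a \<longleftrightarrow> (\<exists>m. a = mdeg m)"
proof
  assume "effective a"
  then have "a = mdeg (Poly_Mapping.map nat a)"
    by (intro poly_mapping_eqI)
       (auto simp: effective_def Poly_Mapping.map.rep_eq when_def)
  then show "\<exists>m. a = mdeg m" ..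
qed auto

lemma divides_iff_add: "divides m m' \<longleftrightarrow> (\<exists>k. m' = m + k)"
proof
  assume "divides m m'"
  then have "m' = m + (m' - m)"
    by (intro poly_mapping_eqI) (simp add: divides_def lookup_add lookup_minus)
  then show "\<exists>k. m' = m + k" ..
qed (auto simp: divides_def lookup_add)

lemma divides_refl [simp]: "divides m m"
  by (simp add: divides_def)

lemma divides_trans: "divides m m' \<Longrightarrow> divides m' m'' \<Longrightarrow> divides m m''"
  unfolding divides_def using le_trans by blast

lemma divides_antisym: "divides m m' \<Longrightarrow> divides m' m \<Longrightarrow> m = m'"
  by (rule poly_mapping_eqI) (auto simp: divides_def intro: le_antisym)

lemma effective_diff_mdeg:
  "effective (a - mdeg m) \<longleftrightarrow> (\<forall>i. int (Poly_Mapping.lookup m i) \<le> Poly_Mapping.lookup a i)"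
  by (simp add: effective_def lookup_minus)

lemma effective_diff_mono:
  assumes "divides m m'" "effective (a - mdeg m')"
  shows "effective (a - mdeg m)"
  using assms unfolding effective_diff_mdeg divides_def by (meson of_nat_mono order_trans)

lemma mdeg_diff: "divides m' m \<Longrightarrow> mdeg (m - m') = mdeg m - mdeg m'"
  by (rule poly_mapping_eqI) (simp add: lookup_minus divides_def of_nat_diff)

lemma total_degree_diff: "total_degree (a - b) = total_degree a - total_degree b"
  by (simp add: total_degree_def lookup_minus sum_subtractf)

lemma total_degree_mdeg_nonneg: "0 \<le> total_degree (mdeg m)"
  by (simp add: total_degree_def sum_nonneg)

lemma total_degree_variable: "total_degree (mdeg (Poly_Mapping.single i 1)) = 1"
proof -
  have "total_degree (mdeg (Poly_Mapping.single i 1)) = (\<Sum>j\<in>UNIV. if i = j then 1 else 0)"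
    unfolding total_degree_def by (intro sum.cong) (auto simp: lookup_single when_def)
  then show ?thesis by simp
qed

lemma lookup_lcm_mon:
  "Poly_Mapping.lookup (lcm_mon W) i = (SUP m\<in>W. Poly_Mapping.lookup m i)"
  by (simp add: lcm_mon_def)

lemma lcm_mon_empty [simp]: "lcm_mon {} = 0"
  by (rule poly_mapping_eqI) (simp add: lookup_lcm_mon)

lemma divides_lcm: "finite W \<Longrightarrow> m \<in> W \<Longrightarrow> divides m (lcm_mon W)"
  by (auto simp: divides_def lookup_lcm_mon intro!: cSup_upper)

lemma lcm_divides_iff:
  assumes "finite W"
  shows "divides (lcm_mon W) b \<longleftrightarrow> (\<forall>m\<in>W. divides m b)"
proof
  assume "\<forall>m\<in>W. divides m b"
  then show "divides (lcm_mon W) b"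
    by (cases "W = {}") (auto simp: divides_def lookup_lcm_mon intro!: cSUP_least)
qed (meson assms divides_lcm divides_trans)

lemma lcm_mon_mono: "finite W \<Longrightarrow> W' \<subseteq> W \<Longrightarrow> divides (lcm_mon W') (lcm_mon W)"
  using lcm_divides_iff[of W'] divides_lcm[of W] finite_subset by blast

lemma lcm_union_divides:
  assumes "finite X" "finite Y"
  shows "divides (lcm_mon (X \<union> Y)) (lcm_mon X + lcm_mon Y)"
proof -
  have "divides (lcm_mon X) (lcm_mon X + lcm_mon Y)" "divides (lcm_mon Y) (lcm_mon X + lcm_mon Y)"
    by (simp_all add: divides_def lookup_add)
  then show ?thesis using assms by (auto simp: lcm_divides_iff)
qed

lemma lcm_mon_eqI:
  assumes "finite W" "finite W'" "\<And>m. m \<in> W \<Longrightarrow> divides m (lcm_mon W')"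
    "\<And>m. m \<in> W' \<Longrightarrow> divides m (lcm_mon W)"
  shows "lcm_mon W = lcm_mon W'"
  using assms by (intro divides_antisym) (auto simp: lcm_divides_iff)

lemma effective_diff_lcm:
  assumes "finite W"
  shows "effective (a - mdeg (lcm_mon W)) \<longleftrightarrow> effective a \<and> (\<forall>m\<in>W. effective (a - mdeg m))"
proof (intro iffI conjI ballI)
  assume *: "effective (a - mdeg (lcm_mon W))"
  show "effective a" using effective_diff_mono[OF _ *, of 0] by (simp add: divides_def)
  show "effective (a - mdeg m)" if "m \<in> W" for m
    using effective_diff_mono[OF _ *] divides_lcm[OF assms that] by blast
next
  assume *: "effective a \<and> (\<forall>m\<in>W. effective (a - mdeg m))"
  then obtain b where b: "a = mdeg b" by (auto simp: effective_iff_mdeg)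
  from * have "\<forall>m\<in>W. divides m b" by (auto simp: b effective_diff_mdeg divides_def)
  then have "divides (lcm_mon W) b" using lcm_divides_iff[OF assms] by blast
  then show "effective (a - mdeg (lcm_mon W))" by (auto simp: b effective_diff_mdeg divides_def)
qed

text \<open>
  The term \<open>k x\<^sup>a\<close> of \<open>S\<close>, with the convention that it is 0 if \<open>a\<close> has a negative entry. With
  it, an element of degree \<open>a\<close> of a free module can be written as a sum over all basis elements,
  including those that do not contribute to degree \<open>a\<close>.
\<close>

definition monomial_of :: "('n::finite \<Rightarrow>\<^sub>0 int) \<Rightarrow> 'k::field \<Rightarrow> ('n, 'k) pring" where
  "monomial_of a k = (if effective a then Poly_Mapping.single (inv mdeg a) k else 0)"

lemma monomial_of_mdeg [simp]: "monomial_of (mdeg m) k = Poly_Mapping.single m k"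
  by (simp add: monomial_of_def inv_f_f[OF inj_mdeg])

lemma monomial_of_add: "monomial_of a (k + l) = monomial_of a k + monomial_of a l"
  by (simp add: monomial_of_def single_add)

lemma monomial_of_zero [simp]: "monomial_of a 0 = 0"
  by (simp add: monomial_of_def)

lemma monomial_of_sum: "monomial_of a (sum f J) = (\<Sum>j\<in>J. monomial_of a (f j))"
  by (induction J rule: infinite_finite_induct) (auto simp: monomial_of_add)

lemma monomial_of_eq_0_iff: "effective a \<Longrightarrow> monomial_of a k = 0 \<longleftrightarrow> k = 0"
  by (metis effective_iff_mdeg lookup_single_eq lookup_zero monomial_of_mdeg single_zero)

lemma monomial_of_mult_single:
  "effective a \<Longrightarrow> monomial_of a k * Poly_Mapping.single m l = monomial_of (a + mdeg m) (k * l)"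
  by (auto simp: effective_iff_mdeg mult_single simp flip: mdeg_add)

lemma minus_one_power_single:
  "(-1 :: ('n::finite, 'k::field) pring) ^ n = Poly_Mapping.single 0 ((-1) ^ n)"
  by (induction n) (auto simp: mult_single single_uminus[symmetric] simp del: single_uminus)

lemma pring_eq_sum_single:
  "s = (\<Sum>m\<in>Poly_Mapping.keys s. Poly_Mapping.single m (Poly_Mapping.lookup s m))"
  by (rule poly_mapping_eqI)
     (auto simp: lookup_sum lookup_single when_def sum.delta in_keys_iff)

lemma module_ring: "module ((*) :: 'a::comm_ring_1 \<Rightarrow> 'a \<Rightarrow> 'a)"
  by unfold_locales (simp_all add: algebra_simps)

text \<open>
  The polynomials all of whose terms are divisible by some monomial of \<open>A\<close> form an ideal
  containing \<open>A\<close>; this makes membership in a monomial ideal visible on the terms.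
\<close>

lemma monomial_ideal_keys:
  fixes s :: "('n::finite, 'k::field) pring"
  assumes "s \<in> ideal_gen (xmon ` A)" "m \<in> Poly_Mapping.keys s"
  shows "\<exists>a\<in>A. divides a m"
proof -
  interpret R: module "(*) :: ('n,'k) pring \<Rightarrow> _" by (rule module_ring)
  let ?T = "{s. \<forall>m\<in>Poly_Mapping.keys s. \<exists>a\<in>A. divides a m}"
  have "R.span (xmon ` A) \<subseteq> ?T"
  proof (rule R.span_minimal)
    show "xmon ` A \<subseteq> ?T" by (force simp: xmon_def)
    show "R.subspace ?T"
    proof (rule R.subspaceI)
      show "x + y \<in> ?T" if "x \<in> ?T" "y \<in> ?T" for x y
        using that keys_add[of x y] by blast
      show "c * x \<in> ?T" if x: "x \<in> ?T" for c x
      proof safe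
        fix m assume "m \<in> Poly_Mapping.keys (c * x)"
        then obtain p q where "m = p + q" and q: "q \<in> Poly_Mapping.keys x"
          using keys_mult[of c x] by blast
        then have "divides q m" by (auto simp: divides_iff_add add.commute)
        with q x show "\<exists>a\<in>A. divides a m" by (blast intro: divides_trans)
      qed
    qed auto
  qed
  with assms show ?thesis by blast
qed

lemma monomial_ideal_multiple:
  fixes A :: "('n::finite, 'k::field) pring set"
  assumes "divides m m'" "xmon m \<in> ideal_gen A"
  shows "xmon m' \<in> ideal_gen A"
proof -
  interpret R: module "(*) :: ('n,'k) pring \<Rightarrow> _" by (rule module_ring)
  obtain k where "m' = k + m" using assms(1) by (auto simp: divides_iff_add add.commute)
  then have "xmon m' = xmon k * (xmon m :: ('n,'k) pring)" by (simp add: xmon_def mult_single)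
  then show ?thesis using R.span_scale[OF assms(2)] by simp
qed

text \<open>
  The ideal has a squarefree generating set \<open>A\<close>. A minimal generator \<open>g\<close> is divisible by some
  \<open>a \<in> A\<close>, which in turn is divisible by some minimal generator; by minimality the
  latter is \<open>g\<close> itself, so \<open>g = a\<close>.
\<close>

lemma minimal_generators_squarefree:
  assumes I: "squarefree_monomial_ideal (I :: ('n::finite, 'k::field) pring set)"
    and G: "minimal_monomial_generators I G" and g: "g \<in> G"
  shows "Poly_Mapping.lookup g i \<le> 1"
proof -
  interpret R: module "(*) :: ('n,'k) pring \<Rightarrow> _" by (rule module_ring)
  obtain A where A: "\<And>m i. m \<in> A \<Longrightarrow> Poly_Mapping.lookup m i \<le> 1" "I = ideal_gen (xmon ` A)"
    using I unfolding squarefree_monomial_ideal_def by blast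
  have IG: "I = ideal_gen (xmon ` G)" and min: "\<And>G'. G' \<subset> G \<Longrightarrow> ideal_gen (xmon ` G') \<noteq> I"
    using G unfolding minimal_monomial_generators_def by blast+
  have "xmon g \<in> I" using g by (auto simp: IG intro: R.span_base)
  then obtain a where a: "a \<in> A" "divides a g"
    using monomial_ideal_keys[of "xmon g" A g] A(2) by (auto simp: xmon_def)
  have "xmon a \<in> I" using a by (auto simp: A(2) intro: R.span_base)
  then obtain h where h: "h \<in> G" "divides h a"
    using monomial_ideal_keys[of "xmon a" G a] IG by (auto simp: xmon_def)
  have "h = g"
  proof (rule ccontr)
    assume "h \<noteq> g"
    let ?J = "ideal_gen (xmon ` (G - {g})) :: ('n,'k) pring set"
    have "xmon h \<in> ?J" using h \<open>h \<noteq> g\<close> by (auto intro: R.span_base)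
    then have "xmon g \<in> ?J" using monomial_ideal_multiple a h divides_trans by blast
    then have "xmon ` G \<subseteq> ?J" by (auto intro: R.span_base)
    then have "I \<subseteq> ?J" unfolding IG by (intro R.span_minimal) auto
    moreover have "?J \<subseteq> I" unfolding IG by (intro R.span_mono) auto
    ultimately show False using min[of "G - {g}"] g by blast
  qed
  then have "g = a" using a h divides_antisym by blast
  then show ?thesis using A(1) a by blast
qed

lemma finite_squarefree: "finite {m :: 'n::finite expo. \<forall>i. Poly_Mapping.lookup m i \<le> 1}"
proof (rule finite_imageD)
  show "inj_on Poly_Mapping.keys {m :: 'n expo. \<forall>i. Poly_Mapping.lookup m i \<le> 1}"
  proof (rule inj_onI, rule poly_mapping_eqI)
    fix m m' :: "'n expo" and i
    assume "m \<in> {m. \<forall>i. Poly_Mapping.lookup m i \<le> 1}"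
      "m' \<in> {m. \<forall>i. Poly_Mapping.lookup m i \<le> 1}" "Poly_Mapping.keys m = Poly_Mapping.keys m'"
    moreover have "i \<in> Poly_Mapping.keys m \<longleftrightarrow> Poly_Mapping.lookup m i \<noteq> 0"
      "i \<in> Poly_Mapping.keys m' \<longleftrightarrow> Poly_Mapping.lookup m' i \<noteq> 0"
      by (simp_all add: in_keys_iff)
    ultimately show "Poly_Mapping.lookup m i = Poly_Mapping.lookup m' i"
      by (metis (mono_tags, lifting) le_Suc_eq le_zero_eq mem_Collect_eq One_nat_def)
  qed
qed simp

section \<open>The Scarf complex\<close>

lemma scarf_unique: "W \<in> scarf G \<Longrightarrow> V \<subseteq> G \<Longrightarrow> lcm_mon V = lcm_mon W \<Longrightarrow> V = W"
  by (auto simp: scarf_def)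

lemma scarf_subset: "W \<in> scarf G \<Longrightarrow> W \<subseteq> G"
  by (auto simp: scarf_def)

text \<open>Adding a divisor of \<open>lcm_mon W\<close> to \<open>W\<close> does not change the lcm, so it cannot be a new element.\<close>

lemma scarf_contains_divisors:
  assumes G: "finite G" and W: "W \<in> scarf G" and m: "m \<in> G" "divides m (lcm_mon W)"
  shows "m \<in> W"
proof -
  have fin: "finite W" using G W scarf_subset finite_subset by blast
  have "insert m W = W"
  proof (rule scarf_unique[OF W])
    show "lcm_mon (insert m W) = lcm_mon W"
      using fin m(2) by (intro lcm_mon_eqI) (auto intro: divides_lcm)
  qed (use m scarf_subset[OF W] in auto)
  then show ?thesis by blast
qed

text \<open>
  The Scarf complex is a simplicial complex. If \<open>V\<close> has the same lcm as \<open>W' \<subseteq> W\<close>, then exchanging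
  them within \<open>W\<close> preserves the lcm: both \<open>V \<union> (W - W')\<close> and \<open>W - (V - W')\<close> have the lcm of \<open>W\<close>
  and hence equal \<open>W\<close>. The first equality yields \<open>W' \<subseteq> V\<close>, the second \<open>V \<subseteq> W'\<close>.
\<close>

lemma scarf_face:
  assumes "finite G" "W \<in> scarf G" "W' \<subseteq> W"
  shows "W' \<in> scarf G"
proof -
  have WG: "W \<subseteq> G" by (rule scarf_subset[OF assms(2)])
  then have fin: "finite W" using assms(1) by (rule finite_subset)
  have fin': "finite W'" by (rule finite_subset[OF assms(3) fin])
  have "V = W'" if V: "V \<subseteq> G" "lcm_mon V = lcm_mon W'" for V
  proof -
    have finV: "finite V" by (rule finite_subset[OF V(1) assms(1)])
    have dV: "divides m (lcm_mon W')" if "m \<in> V" for m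
      using divides_lcm[OF finV that] V(2) by simp
    have dW': "divides m (lcm_mon V)" if "m \<in> W'" for m
      using divides_lcm[OF fin' that] V(2) by simp
    have VW: "V \<subseteq> W"
    proof
      fix m assume "m \<in> V"
      then have "divides m (lcm_mon W)"
        using dV divides_trans lcm_mon_mono[OF fin assms(3)] by blast
      then show "m \<in> W"
        using scarf_contains_divisors[OF assms(1,2)] V(1) \<open>m \<in> V\<close> by blast
    qed
    have "V \<union> (W - W') = W"
    proof (rule scarf_unique[OF assms(2)])
      let ?X = "V \<union> (W - W')"
      have finX: "finite ?X" using finV fin by blast
      have VX: "divides (lcm_mon V) (lcm_mon ?X)"
        using finX by (intro lcm_mon_mono) blast+
      show "lcm_mon ?X = lcm_mon W"
      proof (rule lcm_mon_eqI[OF finX fin])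
        show "divides m (lcm_mon ?X)" if "m \<in> W" for m
        proof (cases "m \<in> W'")
          case True
          then show ?thesis using dW' VX by (blast intro: divides_trans)
        qed (use that divides_lcm[OF finX] in blast)
        show "divides m (lcm_mon W)" if "m \<in> ?X" for m
          using that VW divides_lcm[OF fin] by blast
      qed
    qed (use V WG in blast)
    moreover have "W - (V - W') = W"
    proof (rule scarf_unique[OF assms(2)])
      let ?X = "W - (V - W')"
      have finX: "finite ?X" using fin by blast
      have WX: "divides (lcm_mon W') (lcm_mon ?X)"
        using finX assms(3) by (intro lcm_mon_mono) blast+
      show "lcm_mon ?X = lcm_mon W"
      proof (rule lcm_mon_eqI[OF finX fin])
        show "divides m (lcm_mon ?X)" if "m \<in> W" for m
        proof (cases "m \<in> V")
          case True
          then show ?thesis using dV WX by (blast intro: divides_trans)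
        qed (use that divides_lcm[OF finX] in blast)
        show "divides m (lcm_mon W)" if "m \<in> ?X" for m
          using that divides_lcm[OF fin] by blast
      qed
    qed (use WG in blast)
    ultimately show "V = W'" using VW assms(3) by blast
  qed
  then show ?thesis using WG assms(3) by (auto simp: scarf_def)
qed

section \<open>Acyclicity of the simplex\<close>

text \<open>
  A chain on the full simplex with vertex set \<open>U\<close>, empty face included, is the function that maps
  each face to its coefficient. The coefficient of a boundary at \<open>W\<close> collects the
  contributions of the cofaces \<open>insert m W\<close>.
\<close>

definition boundary :: "'a rel \<Rightarrow> 'a set \<Rightarrow> ('a set \<Rightarrow> 'k::comm_ring_1) \<Rightarrow> 'a set \<Rightarrow> 'k" where
  "boundary r U c W = (\<Sum>m\<in>U - W. (-1) ^ sigma1 r m (insert m W) * c (insert m W))"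

definition cone :: "'a \<Rightarrow> ('a set \<Rightarrow> 'k::comm_ring_1) \<Rightarrow> 'a set \<Rightarrow> 'k" where
  "cone v c W = (if v \<in> W then c (W - {v}) else 0)"

text \<open>
  The cone over a vertex \<open>v\<close> is a contracting homotopy. That \<open>v\<close> precedes all other vertices of
  the chain makes the sign of \<open>v\<close> in \<open>insert v W\<close> positive and flips the sign of every
  other vertex.
\<close>

lemma cone_homotopy:
  assumes "finite U" "v \<in> U" and r: "irrefl r" "trans r"
    and supp: "\<And>W. c W \<noteq> 0 \<Longrightarrow> W \<subseteq> U \<and> (\<forall>m\<in>W. m = v \<or> (v, m) \<in> r)"
  shows "boundary r U (cone v c) W + cone v (boundary r U c) W = c W"
proof -
  have not_below: "(m, v) \<notin> r" if "m = v \<or> (v, m) \<in> r" for m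
    using that r by (metis irreflD transD)
  show ?thesis
  proof (cases "v \<in> W")
    case False
    have "boundary r U (cone v c) W =
        (\<Sum>m\<in>U - W. if m = v then (-1) ^ sigma1 r v (insert v W) * c W else 0)"
      unfolding boundary_def using False by (intro sum.cong) (auto simp: cone_def)
    also have "\<dots> = (-1) ^ sigma1 r v (insert v W) * c W"
      using assms(1,2) False by (simp add: sum.delta)
    also have "\<dots> = c W"
    proof (cases "c W = 0")
      case False
      then have "(m, v) \<notin> r" if "m \<in> insert v W" for m
        using that not_below supp[of W] by blast
      then have "{m \<in> insert v W. (m, v) \<in> r} = {}" by blast
      then have "sigma1 r v (insert v W) = 0" by (simp only: sigma1_def card.empty)
      then show ?thesis by simp
    qed simp
    finally show ?thesis using False by (simp add: cone_def)
  next
    case True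
    let ?t = "\<lambda>m. (-1) ^ sigma1 r m (insert m (W - {v})) * c (insert m (W - {v}))"
    have "boundary r U (cone v c) W = (\<Sum>m\<in>U - W. - ?t m)"
      unfolding boundary_def
    proof (intro sum.cong refl)
      fix m assume m: "m \<in> U - W"
      then have e: "insert m W - {v} = insert m (W - {v})" using True by auto
      show "(-1) ^ sigma1 r m (insert m W) * cone v c (insert m W) = - ?t m"
      proof (cases "c (insert m (W - {v})) = 0")
        case False
        from supp[OF this] have vm: "(v, m) \<in> r" and sub: "insert m (W - {v}) \<subseteq> U"
          using m True by auto
        have fin: "finite (insert m (W - {v}))" by (rule finite_subset[OF sub assms(1)])
        let ?A = "{m' \<in> insert m (W - {v}). (m', m) \<in> r}"
        have "{m' \<in> insert m W. (m', m) \<in> r} = insert v ?A"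
          using vm True by auto
        moreover have "card (insert v ?A) = Suc (card ?A)"
          using fin m True by (intro card_insert_disjoint) auto
        ultimately have "sigma1 r m (insert m W) = Suc (sigma1 r m (insert m (W - {v})))"
          unfolding sigma1_def by (rule trans[OF arg_cong])
        then show ?thesis using True by (simp add: cone_def e)
      qed (use True in \<open>simp add: cone_def e\<close>)
    qed
    moreover have "boundary r U c (W - {v}) = ?t v + (\<Sum>m\<in>U - W. ?t m)"
    proof -
      have "U - (W - {v}) = insert v (U - W)" using True assms(2) by auto
      then show ?thesis unfolding boundary_def using assms(1) True by simp
    qed
    moreover have "?t v = c W"
    proof (cases "c W = 0")
      case False
      then have "(m, v) \<notin> r" if "m \<in> W" for m
        using that not_below supp[of W] by blast
      then have "{m \<in> W. (m, v) \<in> r} = {}" by blast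
      then have "sigma1 r v W = 0" by (simp only: sigma1_def card.empty)
      then show ?thesis using True by (simp add: insert_absorb)
    qed (use True in \<open>simp add: insert_absorb\<close>)
    ultimately show ?thesis using True by (simp add: cone_def sum_negf)
  qed
qed

section \<open>Minimal multigraded resolutions\<close>

locale minimal_resolution =
  fixes I :: "('n::finite, 'k::field) pring set"
    and scale :: "('n, 'k) pring \<Rightarrow> 'f::ab_group_add \<Rightarrow> 'f"
    and H :: "nat \<Rightarrow> 'f set"
    and D :: "('n \<Rightarrow>\<^sub>0 int) \<Rightarrow> 'f set"
    and d :: "'f \<Rightarrow> 'f"
    and one :: 'f
  assumes resolution: "minimal_free_resolution I scale H D d one"
begin

lemma complex: "graded_free_complex scale H D d"
  using resolution by (simp add: minimal_free_resolution_def)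

lemma multigraded: "multigraded_module scale D"
  using complex by (simp add: graded_free_complex_def)

sublocale module scale
  using multigraded by (simp add: multigraded_module_def)

sublocale d: module_hom scale scale d
  using complex by (simp add: graded_free_complex_def)

lemma D_sum: "internal_direct_sum D"
  using multigraded by (simp add: multigraded_module_def)

lemma H_sum: "internal_direct_sum H"
  using complex by (simp add: graded_free_complex_def)

lemma D_single: "x \<in> D a \<Longrightarrow> scale (Poly_Mapping.single m c) x \<in> D (a + mdeg m)"
  using multigraded by (simp add: multigraded_module_def)

lemma H_homogeneous_basis: "\<exists>B. finite B \<and> B \<subseteq> (\<Union>a. D a) \<and> span B = H i"
proof -
  have "\<forall>i. \<exists>B. finite B \<and> B \<subseteq> (\<Union>a. D a) \<and> is_basis scale (H i) B"
    using complex unfolding graded_free_complex_def by - (elim conjE; assumption)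
  then show ?thesis unfolding is_basis_def by meson
qed

lemma H_subspace: "subspace (H i)"
  using H_homogeneous_basis[of i] subspace_span by metis

lemma differential:
  "\<forall>a. d ` D a \<subseteq> D a" "\<forall>i. d ` H (Suc i) \<subseteq> H i" "\<forall>x. d (d x) = 0"
  using complex unfolding graded_free_complex_def by - (elim conjE; assumption)+

lemma d_D: "x \<in> D a \<Longrightarrow> d x \<in> D a"
  using differential(1) by blast

lemma d_H: "x \<in> H (Suc i) \<Longrightarrow> d x \<in> H i"
  using differential(2) by blast

lemma d_d: "d (d x) = 0"
  using differential(3) by blast

lemma acyclic:
  "bij_betw (\<lambda>s. scale s one) UNIV (H 0)" "{s. scale s one \<in> d ` H 1} = I"
  "\<forall>i. {x \<in> H (Suc i). d x = 0} = d ` H (Suc (Suc i))" "minimal_complex scale d"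
  using resolution unfolding minimal_free_resolution_def by - (elim conjE; assumption)+

lemma exact:
  assumes "x \<in> H (Suc i)" "d x = 0"
  shows "\<exists>y\<in>H (Suc (Suc i)). d y = x"
proof -
  have "x \<in> {x \<in> H (Suc i). d x = 0}" using assms by simp
  then have "x \<in> d ` H (Suc (Suc i))" using acyclic(3) by (simp only:)
  then show ?thesis by blast
qed

lemma one_D: "one \<in> D 0"
  using resolution by (simp add: minimal_free_resolution_def)

lemma H0_eq: "H 0 = range (\<lambda>s. scale s one)"
  using acyclic(1) by (simp add: bij_betw_def)

lemma augmentation: "scale s one \<in> d ` H 1 \<longleftrightarrow> s \<in> I"
  using acyclic(2) by blast

lemma minimal: "d x \<in> span {scale (xmon (Poly_Mapping.single i 1)) y | i y. True}"
  using acyclic(4) unfolding minimal_complex_def by blast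

lemma component_D_single:
  "component D a (scale (Poly_Mapping.single m c) x) =
     scale (Poly_Mapping.single m c) (component D (a - mdeg m) x)"
proof -
  have "inj (\<lambda>a. a + mdeg m)" by (rule injI) simp
  from component_commute[where h = "scale (Poly_Mapping.single m c)" and s = "\<lambda>a. a + mdeg m"
      and i = "a - mdeg m" and x = x, OF D_sum scale_right_distrib D_single this]
  show ?thesis by simp
qed

lemma component_D_scale:
  "component D a (scale s x) = (\<Sum>m\<in>Poly_Mapping.keys s.
     scale (Poly_Mapping.single m (Poly_Mapping.lookup s m)) (component D (a - mdeg m) x))"
proof -
  let ?t = "\<lambda>m. Poly_Mapping.single m (Poly_Mapping.lookup s m)"
  have "scale s x = (\<Sum>m\<in>Poly_Mapping.keys s. scale (?t m) x)"
    by (simp only: scale_sum_left[symmetric] pring_eq_sum_single[symmetric])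
  then show ?thesis by (simp add: component_sum[OF D_sum] component_D_single)
qed

lemma component_D_d: "component D a (d x) = d (component D a x)"
  by (rule component_commute[where h = d and s = "\<lambda>a. a", OF D_sum d.add d_D]) auto

lemma component_H_scale: "component H i (scale s x) = scale s (component H i x)"
  by (rule component_commute[where h = "scale s" and s = "\<lambda>i. i",
        OF H_sum scale_right_distrib subspace_scale[OF H_subspace]]) auto

lemma component_D_H:
  assumes "x \<in> H i"
  shows "component D a x \<in> H i"
proof -
  obtain B where B: "B \<subseteq> (\<Union>a. D a)" "span B = H i"
    using H_homogeneous_basis by blast
  let ?T = "{x. \<forall>a. component D a x \<in> H i}"
  have "span B \<subseteq> ?T"
  proof (rule span_minimal)
    show "B \<subseteq> ?T"
    proof safe
      fix b a assume b: "b \<in> B"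
      then obtain a' where "b \<in> D a'" using B by blast
      then show "component D a b \<in> H i"
        using b B span_base[of b B] span_zero[of B] by (simp add: component_mem[OF D_sum])
    qed
    show "subspace ?T"
      by (rule subspaceI)
         (auto simp: component_zero[OF D_sum] component_add[OF D_sum] component_D_scale
           intro!: subspace_sum[OF H_subspace] subspace_0[OF H_subspace]
             subspace_add[OF H_subspace] subspace_scale[OF H_subspace])
  qed
  then show ?thesis using assms B by blast
qed

text \<open>
  Each \<open>H i\<close> has only finitely many generators, so it vanishes in all multidegrees of small total
  degree. This is what makes an induction on the total degree well founded.
\<close>

lemma bounded_below: "\<exists>N. \<forall>a. total_degree a < N \<longrightarrow> H i \<inter> D a \<subseteq> {0}"
proof -
  obtain B where B: "finite B" "B \<subseteq> (\<Union>a. D a)" "span B = H i"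
    using H_homogeneous_basis by blast
  then have "\<forall>b\<in>B. \<exists>a. b \<in> D a" by blast
  then obtain deg where deg: "\<And>b. b \<in> B \<Longrightarrow> b \<in> D (deg b)" by metis
  \<comment> \<open>The 0 only ensures that the minimum is taken over a nonempty set, as \<open>B\<close> may be empty.\<close>
  define N where "N = Min (insert 0 (total_degree ` deg ` B))"
  have N: "N \<le> total_degree (deg b)" if "b \<in> B" for b
    using B(1) that unfolding N_def by (intro Min_le) auto
  let ?T = "{x. \<forall>a. total_degree a < N \<longrightarrow> component D a x = 0}"
  have "span B \<subseteq> ?T"
  proof (rule span_minimal)
    show "B \<subseteq> ?T"
      using N by (force simp: component_mem[OF D_sum deg])
    show "subspace ?T"
    proof (rule subspaceI)
      show "scale s x \<in> ?T" if x: "x \<in> ?T" for s x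
      proof safe
        fix a :: "'n \<Rightarrow>\<^sub>0 int"
        assume a: "total_degree a < N"
        have "component D (a - mdeg m) x = 0" for m :: "'n expo"
          using x a total_degree_mdeg_nonneg[of m] by (simp add: total_degree_diff)
        then show "component D a (scale s x) = 0" by (simp add: component_D_scale)
      qed
    qed (auto simp: component_zero[OF D_sum] component_add[OF D_sum])
  qed
  then have "x = 0" if "total_degree a < N" "x \<in> H i" "x \<in> D a" for a x
    using that B(3) component_mem[OF D_sum that(3), of a] by auto
  then show ?thesis by blast
qed

text \<open>A preimage of a homogeneous cycle can be replaced by its component of the right multidegree.\<close>

lemma exact_homogeneous:
  assumes "x \<in> H (Suc i)" "x \<in> D a" "d x = 0"
  shows "\<exists>y\<in>H (Suc (Suc i)) \<inter> D a. d y = x"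
proof -
  obtain y where y: "y \<in> H (Suc (Suc i))" "d y = x" using exact assms by blast
  have "d (component D a y) = x"
    using component_mem[OF D_sum assms(2), of a] y by (simp flip: component_D_d)
  then show ?thesis using component_D_H[OF y(1)] component_decomposition(2)[OF D_sum] by blast
qed

text \<open>
  Minimality writes a boundary as \<open>\<Sum>\<^sub>j x\<^sub>j z\<^sub>j\<close> with arbitrary \<open>z\<^sub>j\<close>. If the boundary is
  homogeneous, then the \<open>z\<^sub>j\<close> can be projected to the matching components of both gradings.
\<close>

lemma minimal_homogeneous:
  assumes "x \<in> H i" "x \<in> D a" "x \<in> range d"
  shows "\<exists>y. (\<forall>j. y j \<in> H i \<inter> D (a - mdeg (Poly_Mapping.single j 1))) \<and>
    x = (\<Sum>j\<in>UNIV. scale (xmon (Poly_Mapping.single j 1)) (y j))"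
proof -
  let ?X = "\<lambda>j::'n. xmon (Poly_Mapping.single j 1) :: ('n, 'k) pring"
  let ?T = "range (\<lambda>y. \<Sum>j\<in>UNIV. scale (?X j) (y j))"
  have "span {scale (?X j) y | j y. True} \<subseteq> ?T"
  proof (rule span_minimal)
    show "{scale (?X j) y | j y. True} \<subseteq> ?T"
    proof safe
      fix j y
      have "(\<Sum>k\<in>UNIV. scale (?X k) (if k = j then y else 0)) =
          (\<Sum>k\<in>UNIV. if k = j then scale (?X k) y else 0)"
        by (intro sum.cong) auto
      then have "scale (?X j) y = (\<Sum>k\<in>UNIV. scale (?X k) (if k = j then y else 0))"
        by simp
      then show "scale (?X j) y \<in> ?T"
        by (rule range_eqI[where x = "\<lambda>k. if k = j then y else 0"])
    qed
    show "subspace ?T"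
    proof (rule subspaceI)
      show "0 \<in> ?T" by (rule range_eqI[of _ _ "\<lambda>_. 0"]) simp
      show "u + v \<in> ?T" if "u \<in> ?T" "v \<in> ?T" for u v
      proof -
        from that obtain y z where "u = (\<Sum>j\<in>UNIV. scale (?X j) (y j))"
          "v = (\<Sum>j\<in>UNIV. scale (?X j) (z j))" by blast
        then have "u + v = (\<Sum>j\<in>UNIV. scale (?X j) (y j + z j))"
          by (simp add: scale_right_distrib sum.distrib)
        then show ?thesis by (rule range_eqI[where x = "\<lambda>j. y j + z j"])
      qed
      show "scale s u \<in> ?T" if "u \<in> ?T" for s u
      proof -
        from that obtain y where "u = (\<Sum>j\<in>UNIV. scale (?X j) (y j))" by blast
        then have "scale s u = (\<Sum>j\<in>UNIV. scale (?X j) (scale s (y j)))"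
          by (simp add: scale_sum_right mult.commute)
        then show ?thesis by (rule range_eqI[where x = "\<lambda>j. scale s (y j)"])
      qed
    qed
  qed
  then obtain z where z: "x = (\<Sum>j\<in>UNIV. scale (?X j) (z j))"
    using minimal assms(3) by blast
  define y where "y j = component D (a - mdeg (Poly_Mapping.single j 1)) (component H i (z j))" for j
  have "x = component D a (component H i x)"
    using assms by (simp add: component_mem[OF D_sum] component_mem[OF H_sum])
  also have "\<dots> = (\<Sum>j\<in>UNIV. scale (?X j) (y j))"
    by (simp add: z component_sum[OF D_sum] component_sum[OF H_sum] component_H_scale
        component_D_single xmon_def y_def)
  finally show ?thesis
    using component_decomposition(2)[OF H_sum] component_decomposition(2)[OF D_sum] component_D_H
    by (intro exI[of _ y]) (auto simp: y_def)
qed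

text \<open>
  A graded Nakayama lemma: additively closed families \<open>N\<close>, stable under multiplication by variables,
  that exhaust \<open>H i\<close> up to boundaries already exhaust \<open>H i\<close>. By minimality a homogeneous
  boundary is a combination \<open>\<Sum>\<^sub>j x\<^sub>j y\<^sub>j\<close>, and the \<open>y\<^sub>j\<close> are covered by induction on the
  total degree. The predicate \<open>ok\<close> restricts the claim to a set of multidegrees that is
  closed under division by variables.
\<close>

lemma graded_nakayama:
  assumes ok: "\<And>a j. ok a \<Longrightarrow> ok (a - mdeg (Poly_Mapping.single j 1))"
    and N0: "\<And>a. 0 \<in> N a" and N_add: "\<And>a x y. x \<in> N a \<Longrightarrow> y \<in> N a \<Longrightarrow> x + y \<in> N a"
    and N_mult: "\<And>a j x. x \<in> N (a - mdeg (Poly_Mapping.single j 1)) \<Longrightarrow>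
      scale (xmon (Poly_Mapping.single j 1)) x \<in> N a"
    and N_sub: "\<And>a. N a \<subseteq> H i \<inter> D a"
    and step: "\<And>a x. ok a \<Longrightarrow> x \<in> H i \<Longrightarrow> x \<in> D a \<Longrightarrow> \<exists>y\<in>N a. x - y \<in> range d"
    and x: "ok a" "x \<in> H i" "x \<in> D a"
  shows "x \<in> N a"
proof -
  obtain L where L: "\<And>a. total_degree a < L \<Longrightarrow> H i \<inter> D a \<subseteq> {0}"
    using bounded_below by blast
  \<comment> \<open>Below total degree \<open>L\<close> there is only 0, so \<open>n\<close> bounds the distance to the trivial range.\<close>
  have "total_degree a < L + int n \<Longrightarrow> x \<in> N a" for n
    using x
  proof (induction n arbitrary: a x)
    case 0
    then show ?case using L[of a] N0 by auto
  next
    case (Suc n)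
    obtain y where y: "y \<in> N a" "x - y \<in> range d"
      using step Suc.prems by blast
    have "x - y \<in> H i" "x - y \<in> D a"
      using y(1) N_sub[of a] Suc.prems direct_sum_diff[OF H_sum] direct_sum_diff[OF D_sum] by auto
    from minimal_homogeneous[OF this y(2)] obtain z where
      z: "\<And>j. z j \<in> H i \<inter> D (a - mdeg (Poly_Mapping.single j 1))"
        "x - y = (\<Sum>j\<in>UNIV. scale (xmon (Poly_Mapping.single j 1)) (z j))"
      by blast
    have zN: "z j \<in> N (a - mdeg (Poly_Mapping.single j 1))" for j
    proof (rule Suc.IH)
      show "total_degree (a - mdeg (Poly_Mapping.single j 1)) < L + int n"
        using Suc.prems(1) total_degree_variable[of j] by (simp add: total_degree_diff)
    qed (use z(1)[of j] ok[OF Suc.prems(2)] in auto)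
    have "sum f J \<in> N a" if "\<And>j. f j \<in> N a" for f and J :: "'n set"
      using that by (induction J rule: infinite_finite_induct) (auto intro: N0 N_add)
    from this[OF N_mult[OF zN]] have "x - y \<in> N a" unfolding z(2) .
    from N_add[OF y(1) this] show ?case by simp
  qed
  from this[of "nat (total_degree a - L + 1)"] show ?thesis by linarith
qed

end

section \<open>The part of the resolution below a Scarf simplex\<close>

lemma strict_linear_order_least:
  assumes "strict_linear_order_on G r" "finite A" "A \<noteq> {}" "A \<subseteq> G"
  shows "\<exists>v\<in>A. \<forall>m\<in>A. m = v \<or> (v, m) \<in> r"
  using assms(2-4)
proof (induction A rule: finite_ne_induct)
  case (insert x F)
  then obtain v where v: "v \<in> F" "\<And>m. m \<in> F \<Longrightarrow> m = v \<or> (v, m) \<in> r" by auto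
  have r: "trans r" "total_on G r" using assms(1) by (auto simp: strict_linear_order_on_def)
  have "x \<in> G" "v \<in> G" "x \<noteq> v" using insert v(1) by auto
  with r(2) consider "(v, x) \<in> r" | "(x, v) \<in> r" unfolding total_on_def by blast
  then show ?case
  proof cases
    case 1
    then show ?thesis using v by blast
  next
    case 2
    have "m = x \<or> (x, m) \<in> r" if "m \<in> insert x F" for m
      using that v(2)[of m] 2 transD[OF r(1) 2, of m] by blast
    then show ?thesis by blast
  qed
qed auto

locale scarf_resolution = minimal_resolution I scale H D d one
  for I :: "('n::finite, 'k::field) pring set"
    and scale :: "('n, 'k) pring \<Rightarrow> 'f::ab_group_add \<Rightarrow> 'f"
    and H :: "nat \<Rightarrow> 'f set"
    and D :: "('n \<Rightarrow>\<^sub>0 int) \<Rightarrow> 'f set"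
    and d :: "'f \<Rightarrow> 'f"
    and one :: 'f +
  fixes G :: "'n expo set"
    and r :: "'n expo rel"
    and \<phi> :: "('n, 'k) taylor \<Rightarrow> 'f"
  assumes squarefree: "squarefree_monomial_ideal I"
    and generators: "minimal_monomial_generators I G"
    and order: "strict_linear_order_on G r"
    and embedding: "scarf_embedding G r scale H D d one \<phi>"
begin

definition g :: "'n expo set \<Rightarrow> 'f" where
  "g W = \<phi> (taylor_basis W)"

lemma order_props: "irrefl r" "trans r" "total_on G r"
  using order by (auto simp: strict_linear_order_on_def)

lemma finite_G: "finite G"
  by (rule finite_subset[OF _ finite_squarefree])
     (use minimal_generators_squarefree[OF squarefree generators] in blast)

lemma scarf_finite: "W \<in> scarf G \<Longrightarrow> finite W"
  using finite_subset[OF scarf_subset finite_G] .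

lemma embedding_rules:
  "\<forall>t\<in>algebraic_scarf G. \<forall>u\<in>algebraic_scarf G. \<phi> (t + u) = \<phi> t + \<phi> u"
  "\<forall>s. \<forall>t\<in>algebraic_scarf G. \<phi> (taylor_scale s t) = scale s (\<phi> t)"
  "inj_on \<phi> (algebraic_scarf G)"
  "\<forall>t\<in>algebraic_scarf G. \<phi> (taylor_diff r t) = d (\<phi> t)"
  "\<forall>W\<in>scarf G. \<phi> (taylor_basis W) \<in> H (card W) \<inter> D (mdeg (lcm_mon W))"
  "\<phi> (taylor_basis {}) = one"
  using embedding unfolding scarf_embedding_def by - (elim conjE; assumption)+

lemma \<phi>_add:
  "\<lbrakk>t \<in> algebraic_scarf G; u \<in> algebraic_scarf G\<rbrakk> \<Longrightarrow> \<phi> (t + u) = \<phi> t + \<phi> u"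
  using embedding_rules(1) by blast

lemma \<phi>_scale: "t \<in> algebraic_scarf G \<Longrightarrow> \<phi> (taylor_scale s t) = scale s (\<phi> t)"
  using embedding_rules(2) by blast

lemma \<phi>_diff: "t \<in> algebraic_scarf G \<Longrightarrow> \<phi> (taylor_diff r t) = d (\<phi> t)"
  using embedding_rules(4) by blast

lemma g_mem: "W \<in> scarf G \<Longrightarrow> g W \<in> H (card W)" "W \<in> scarf G \<Longrightarrow> g W \<in> D (mdeg (lcm_mon W))"
  using embedding_rules(5) unfolding g_def by blast+

lemma g_empty: "g {} = one"
  unfolding g_def by (rule embedding_rules(6))

lemma lookup_taylor_scale:
  "Poly_Mapping.lookup (taylor_scale s t) W = s * Poly_Mapping.lookup t W"
  by (simp add: taylor_scale_def Poly_Mapping.map.rep_eq when_def)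

lemma taylor_scale_one: "taylor_scale 1 t = t"
  by (rule poly_mapping_eqI) (simp add: lookup_taylor_scale)

lemma basis_algebraic_scarf: "W \<in> scarf G \<Longrightarrow> taylor_scale s (taylor_basis W) \<in> algebraic_scarf G"
  by (auto simp: algebraic_scarf_def in_keys_iff lookup_taylor_scale taylor_basis_def
      lookup_single when_def split: if_splits)

lemma taylor_basis_algebraic_scarf: "W \<in> scarf G \<Longrightarrow> taylor_basis W \<in> algebraic_scarf G"
  using basis_algebraic_scarf[of W 1] by (simp add: taylor_scale_one)

lemma sum_algebraic_scarf:
  "(\<And>j. j \<in> J \<Longrightarrow> f j \<in> algebraic_scarf G) \<Longrightarrow> sum f J \<in> algebraic_scarf G"
  using keys_sum[of f J] by (fastforce simp: algebraic_scarf_def)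

lemma \<phi>_combination:
  assumes "finite J" "\<And>j. j \<in> J \<Longrightarrow> w j \<in> scarf G"
  shows "\<phi> (\<Sum>j\<in>J. taylor_scale (s j) (taylor_basis (w j))) = (\<Sum>j\<in>J. scale (s j) (g (w j)))"
  using assms
proof (induction J rule: finite_induct)
  case empty
  have "(0 :: ('n, 'k) taylor) \<in> algebraic_scarf G" by (simp add: algebraic_scarf_def)
  from \<phi>_add[OF this this] show ?case by simp
next
  case (insert x J)
  have x: "w x \<in> scarf G" and J: "\<And>j. j \<in> J \<Longrightarrow> w j \<in> scarf G" using insert.prems by blast+
  have "\<phi> (taylor_scale (s x) (taylor_basis (w x)) + (\<Sum>j\<in>J. taylor_scale (s j) (taylor_basis (w j)))) =
      \<phi> (taylor_scale (s x) (taylor_basis (w x))) +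
      \<phi> (\<Sum>j\<in>J. taylor_scale (s j) (taylor_basis (w j)))"
    by (intro \<phi>_add basis_algebraic_scarf x sum_algebraic_scarf J)
  also have "\<phi> (taylor_scale (s x) (taylor_basis (w x))) = scale (s x) (g (w x))"
    unfolding g_def by (intro \<phi>_scale taylor_basis_algebraic_scarf x)
  finally show ?case using insert.IH[OF J] insert.hyps by simp
qed

text \<open>Injectivity of \<open>\<phi>\<close> transports the independence of the Taylor basis to the resolution.\<close>

lemma g_independent:
  assumes X: "finite X" "X \<subseteq> scarf G" and "(\<Sum>W\<in>X. scale (s W) (g W)) = 0" and "W \<in> X"
  shows "s W = 0"
proof -
  let ?t = "\<Sum>W\<in>X. taylor_scale (s W) (taylor_basis W)"
  have "\<phi> ?t = \<phi> 0"
    using \<phi>_combination[of X "\<lambda>W. W" s] \<phi>_combination[of "{}" "\<lambda>W. W" s] assms by auto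
  moreover have "?t \<in> algebraic_scarf G"
    using X by (auto intro!: sum_algebraic_scarf basis_algebraic_scarf)
  moreover have "0 \<in> algebraic_scarf G" by (simp add: algebraic_scarf_def)
  ultimately have "?t = 0" using inj_onD[OF embedding_rules(3)] by blast
  then have "0 = Poly_Mapping.lookup ?t W" by simp
  also have "\<dots> = (\<Sum>V\<in>X. if V = W then s V else 0)"
    by (simp add: lookup_sum lookup_taylor_scale taylor_basis_def lookup_single when_def
        if_distrib cong: if_cong)
  also have "\<dots> = s W" using X assms(4) by simp
  finally show ?thesis by simp
qed

lemma d_g:
  assumes "W \<in> scarf G"
  shows "d (g W) = (\<Sum>m\<in>W. scale ((-1) ^ sigma1 r m W * xmon (lcm_mon W - lcm_mon (W - {m})))
    (g (W - {m})))"
proof -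
  have "d (g W) = \<phi> (taylor_diff r (taylor_basis W))"
    using \<phi>_diff[OF taylor_basis_algebraic_scarf[OF assms]] by (simp add: g_def)
  also have "taylor_diff r (taylor_basis W) = (\<Sum>m\<in>W. taylor_scale ((-1) ^ sigma1 r m W *
      xmon (lcm_mon W - lcm_mon (W - {m}))) (taylor_basis (W - {m}) :: ('n, 'k) taylor))"
    by (simp add: taylor_diff_def taylor_basis_def taylor_scale_one)
  also have "\<phi> \<dots> = (\<Sum>m\<in>W. scale ((-1) ^ sigma1 r m W *
      xmon (lcm_mon W - lcm_mon (W - {m}))) (g (W - {m})))"
    by (rule \<phi>_combination)
       (use assms scarf_finite scarf_face[OF finite_G] in auto)
  finally show ?thesis .
qed

text \<open>
  The element \<open>k x\<^sup>a\<^sup>-\<^sup>b g\<^sub>W\<close>, where \<open>b\<close> is the multidegree of \<open>g\<^sub>W\<close>. In this normalisation all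
  monomial coefficients of the Taylor differential disappear: within the fixed multidegree \<open>a\<close>
  it becomes the simplicial boundary over the field.
\<close>

definition graded_term :: "('n \<Rightarrow>\<^sub>0 int) \<Rightarrow> 'n expo set \<Rightarrow> 'k \<Rightarrow> 'f" where
  "graded_term a W k = scale (monomial_of (a - mdeg (lcm_mon W)) k) (g W)"

lemma graded_term_zero [simp]: "graded_term a W 0 = 0"
  by (simp add: graded_term_def)

lemma graded_term_add: "graded_term a W (k + l) = graded_term a W k + graded_term a W l"
  by (simp add: graded_term_def monomial_of_add scale_left_distrib)

lemma graded_term_sum: "graded_term a W (sum f J) = (\<Sum>j\<in>J. graded_term a W (f j))"
  by (simp add: graded_term_def monomial_of_sum scale_sum_left)

lemma graded_term_mem:
  assumes "W \<in> scarf G"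
  shows "graded_term a W k \<in> H (card W)" "graded_term a W k \<in> D a"
proof -
  show "graded_term a W k \<in> H (card W)"
    unfolding graded_term_def by (intro subspace_scale[OF H_subspace] g_mem(1) assms)
  show "graded_term a W k \<in> D a"
  proof (cases "effective (a - mdeg (lcm_mon W))")
    case True
    then obtain q where q: "a - mdeg (lcm_mon W) = mdeg q" by (auto simp: effective_iff_mdeg)
    have "a = mdeg (lcm_mon W) + mdeg q" by (simp flip: q)
    then show ?thesis
      using D_single[OF g_mem(2)[OF assms], of q k] by (simp add: graded_term_def q)
  next
    case False
    then show ?thesis
      by (simp add: graded_term_def monomial_of_def direct_sum_zero[OF D_sum])
  qed
qed

lemma scale_graded_term:
  assumes "effective (a - mdeg (lcm_mon W))"
  shows "scale ((-1) ^ n * xmon q) (graded_term a W k) = graded_term (a + mdeg q) W ((-1) ^ n * k)"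
proof -
  have "((-1) ^ n * xmon q) * monomial_of (a - mdeg (lcm_mon W)) k =
      monomial_of (a - mdeg (lcm_mon W)) k * Poly_Mapping.single q ((-1) ^ n)"
    by (simp add: minus_one_power_single xmon_def mult_single mult.commute)
  also have "\<dots> = monomial_of (a - mdeg (lcm_mon W) + mdeg q) (k * (-1) ^ n)"
    by (rule monomial_of_mult_single[OF assms])
  also have "a - mdeg (lcm_mon W) + mdeg q = a + mdeg q - mdeg (lcm_mon W)" by simp
  finally show ?thesis by (simp add: graded_term_def mult.commute)
qed

lemma d_graded_term:
  assumes W: "W \<in> scarf G" and eff: "effective (a - mdeg (lcm_mon W))"
  shows "d (graded_term a W k) = (\<Sum>m\<in>W. graded_term a (W - {m}) ((-1) ^ sigma1 r m W * k))"
proof -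
  obtain q where q: "a - mdeg (lcm_mon W) = mdeg q" using eff by (auto simp: effective_iff_mdeg)
  have "d (graded_term a W k) = scale (Poly_Mapping.single q k) (d (g W))"
    by (simp add: graded_term_def d.scale q)
  also have "\<dots> = (\<Sum>m\<in>W. scale (Poly_Mapping.single q k)
      (scale ((-1) ^ sigma1 r m W * xmon (lcm_mon W - lcm_mon (W - {m}))) (g (W - {m}))))"
    by (simp only: d_g[OF W] scale_sum_right)
  also have "\<dots> = (\<Sum>m\<in>W. graded_term a (W - {m}) ((-1) ^ sigma1 r m W * k))"
  proof (intro sum.cong refl)
    fix m assume "m \<in> W"
    let ?p = "lcm_mon W - lcm_mon (W - {m})"
    have "mdeg ?p = mdeg (lcm_mon W) - mdeg (lcm_mon (W - {m}))"
      by (intro mdeg_diff lcm_mon_mono scarf_finite[OF W]) auto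
    then have "a - mdeg (lcm_mon (W - {m})) = mdeg (q + ?p)"
      using q by (simp add: mdeg_add algebra_simps)
    then show "scale (Poly_Mapping.single q k)
        (scale ((-1) ^ sigma1 r m W * xmon ?p) (g (W - {m}))) =
      graded_term a (W - {m}) ((-1) ^ sigma1 r m W * k)"
      by (simp add: graded_term_def minus_one_power_single xmon_def mult_single mult.commute)
  qed
  finally show ?thesis .
qed

text \<open>
  Coefficient functions that vanish on the faces whose lcm does not divide \<open>x\<^sup>a\<close>. On such functions
  \<open>chain_sum\<close> below loses no information.
\<close>

definition graded_chain :: "'n expo set \<Rightarrow> ('n \<Rightarrow>\<^sub>0 int) \<Rightarrow> ('n expo set \<Rightarrow> 'k) \<Rightarrow> bool" where
  "graded_chain U a c \<longleftrightarrow> (\<forall>W. c W \<noteq> 0 \<longrightarrow> W \<subseteq> U \<and> effective (a - mdeg (lcm_mon W)))"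

definition chain_sum :: "'n expo set \<Rightarrow> ('n \<Rightarrow>\<^sub>0 int) \<Rightarrow> ('n expo set \<Rightarrow> 'k) \<Rightarrow> 'f" where
  "chain_sum U a c = (\<Sum>W\<in>Pow U. graded_term a W (c W))"

definition chains :: "'n expo set \<Rightarrow> nat \<Rightarrow> ('n \<Rightarrow>\<^sub>0 int) \<Rightarrow> 'f set" where
  "chains U i a = {chain_sum U a c | c. graded_chain U a c \<and> (\<forall>W. c W \<noteq> 0 \<longrightarrow> card W = i)}"

lemma graded_chain_boundary:
  assumes U: "finite U" and c: "graded_chain U a c"
  shows "graded_chain U a (boundary r U c)"
  unfolding graded_chain_def
proof (intro allI impI)
  fix W assume "boundary r U c W \<noteq> 0"
  then obtain m where "m \<in> U" "c (insert m W) \<noteq> 0"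
    unfolding boundary_def by (auto elim!: sum.not_neutral_contains_not_neutral)
  then have sub: "insert m W \<subseteq> U" and eff: "effective (a - mdeg (lcm_mon (insert m W)))"
    using c by (auto simp: graded_chain_def)
  have "divides (lcm_mon W) (lcm_mon (insert m W))"
    using finite_subset[OF sub U] by (intro lcm_mon_mono) auto
  then show "W \<subseteq> U \<and> effective (a - mdeg (lcm_mon W))"
    using sub eff effective_diff_mono by blast
qed

lemma d_chain_sum:
  assumes U: "U \<in> scarf G" and c: "graded_chain U a c"
  shows "d (chain_sum U a c) = chain_sum U a (boundary r U c)"
proof -
  have fin: "finite U" using U by (rule scarf_finite)
  have finW: "finite W" if "W \<in> Pow U" for W using that fin finite_subset by auto
  have "d (chain_sum U a c) = (\<Sum>W\<in>Pow U. d (graded_term a W (c W)))"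
    by (simp add: chain_sum_def d.sum)
  also have "\<dots> = (\<Sum>W\<in>Pow U. \<Sum>m\<in>W. graded_term a (W - {m}) ((-1) ^ sigma1 r m W * c W))"
  proof (intro sum.cong refl)
    fix W assume W: "W \<in> Pow U"
    show "d (graded_term a W (c W)) =
        (\<Sum>m\<in>W. graded_term a (W - {m}) ((-1) ^ sigma1 r m W * c W))"
    proof (cases "c W = 0")
      case False
      have "W \<in> scarf G" using scarf_face[OF finite_G U] W by blast
      moreover have "effective (a - mdeg (lcm_mon W))" using c False by (simp add: graded_chain_def)
      ultimately show ?thesis by (rule d_graded_term)
    qed simp
  qed
  also have "\<dots> = (\<Sum>(W, m)\<in>(SIGMA W:Pow U. W).
      graded_term a (W - {m}) ((-1) ^ sigma1 r m W * c W))"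
    using fin finW by (subst sum.Sigma) auto
  \<comment> \<open>A face \<open>W\<close> with a vertex \<open>m\<close> corresponds to the face \<open>X = W - {m}\<close> with a vertex outside it.\<close>
  also have "\<dots> = (\<Sum>(X, m)\<in>(SIGMA X:Pow U. U - X).
      graded_term a X ((-1) ^ sigma1 r m (insert m X) * c (insert m X)))"
    by (rule sum.reindex_bij_witness[of _ "\<lambda>(X, m). (insert m X, m)" "\<lambda>(W, m). (W - {m}, m)"])
       (auto simp: insert_absorb)
  also have "\<dots> = (\<Sum>X\<in>Pow U. \<Sum>m\<in>U - X.
      graded_term a X ((-1) ^ sigma1 r m (insert m X) * c (insert m X)))"
    using fin by (subst sum.Sigma) auto
  also have "\<dots> = chain_sum U a (boundary r U c)"
    by (simp add: chain_sum_def boundary_def graded_term_sum)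
  finally show ?thesis .
qed

lemma chain_sum_eq_0:
  assumes U: "U \<in> scarf G" and c: "graded_chain U a c" and "chain_sum U a c = 0"
  shows "c W = 0"
proof (rule ccontr)
  assume W: "c W \<noteq> 0"
  then have sub: "W \<in> Pow U" and eff: "effective (a - mdeg (lcm_mon W))"
    using c by (auto simp: graded_chain_def)
  have "Pow U \<subseteq> scarf G" using scarf_face[OF finite_G U] by blast
  from g_independent[OF _ this _ sub, of "\<lambda>W. monomial_of (a - mdeg (lcm_mon W)) (c W)"]
  have "monomial_of (a - mdeg (lcm_mon W)) (c W) = 0"
    using assms(3) scarf_finite[OF U] by (simp add: chain_sum_def graded_term_def)
  then show False using W monomial_of_eq_0_iff[OF eff] by blast
qed

lemma chains_subset:
  assumes U: "U \<in> scarf G"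
  shows "chains U i a \<subseteq> H i \<inter> D a"
proof
  fix x assume "x \<in> chains U i a"
  then obtain c where x: "x = chain_sum U a c" and c: "\<And>W. c W \<noteq> 0 \<Longrightarrow> card W = i"
    by (auto simp: chains_def)
  have "graded_term a W (c W) \<in> H i" "graded_term a W (c W) \<in> D a" if "W \<in> Pow U" for W
  proof -
    have W: "W \<in> scarf G" using scarf_face[OF finite_G U] that by blast
    show "graded_term a W (c W) \<in> D a" using graded_term_mem[OF W] by blast
    show "graded_term a W (c W) \<in> H i"
      using graded_term_mem(1)[OF W, of a "c W"] c[of W] direct_sum_zero[OF H_sum]
      by (cases "c W = 0") auto
  qed
  then show "x \<in> H i \<inter> D a"
    unfolding x chain_sum_def by (intro IntI direct_sum_sum[OF H_sum] direct_sum_sum[OF D_sum]; blast)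
qed

lemma chains_zero: "0 \<in> chains U i a"
  unfolding chains_def by (auto simp: graded_chain_def chain_sum_def intro!: exI[of _ "\<lambda>_. 0"])

lemma chains_add:
  assumes "x \<in> chains U i a" "y \<in> chains U i a"
  shows "x + y \<in> chains U i a"
proof -
  obtain b c where b: "x = chain_sum U a b" "graded_chain U a b" "\<And>W. b W \<noteq> 0 \<Longrightarrow> card W = i"
    and c: "y = chain_sum U a c" "graded_chain U a c" "\<And>W. c W \<noteq> 0 \<Longrightarrow> card W = i"
    using assms unfolding chains_def by blast
  have nz: "b W \<noteq> 0 \<or> c W \<noteq> 0" if "b W + c W \<noteq> 0" for W using that by auto
  have "x + y = chain_sum U a (\<lambda>W. b W + c W)"
    by (simp add: b(1) c(1) chain_sum_def graded_term_add sum.distrib)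
  moreover have "graded_chain U a (\<lambda>W. b W + c W)"
    using b(2) c(2) nz unfolding graded_chain_def by blast
  ultimately show ?thesis unfolding chains_def using nz b(3) c(3) by blast
qed

lemma chains_sum:
  "(\<And>j. j \<in> J \<Longrightarrow> f j \<in> chains U i a) \<Longrightarrow> sum f J \<in> chains U i a"
  by (induction J rule: infinite_finite_induct) (auto intro: chains_zero chains_add)

lemma graded_term_chains:
  assumes "finite U" "W \<subseteq> U"
  shows "graded_term a W k \<in> chains U (card W) a"
proof (cases "effective (a - mdeg (lcm_mon W))")
  case True
  let ?c = "\<lambda>X. if X = W then k else 0"
  have "chain_sum U a ?c = (\<Sum>X\<in>Pow U. if X = W then graded_term a X k else 0)"
    unfolding chain_sum_def by (intro sum.cong) auto
  also have "\<dots> = graded_term a W k" using assms by simp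
  finally have eq: "graded_term a W k = chain_sum U a ?c" by simp
  have "graded_chain U a ?c \<and> (\<forall>X. ?c X \<noteq> 0 \<longrightarrow> card X = card W)"
    using assms True by (auto simp: graded_chain_def)
  then show ?thesis unfolding chains_def eq by blast
next
  case False
  then show ?thesis by (simp add: graded_term_def monomial_of_def chains_zero)
qed

lemma chains_scale:
  assumes "x \<in> chains U i (a - mdeg m)"
  shows "scale (xmon m) x \<in> chains U i a"
proof -
  obtain c where x: "x = chain_sum U (a - mdeg m) c" and c: "graded_chain U (a - mdeg m) c"
    "\<And>W. c W \<noteq> 0 \<Longrightarrow> card W = i"
    using assms unfolding chains_def by blast
  have "scale (xmon m) (graded_term (a - mdeg m) W (c W)) = graded_term a W (c W)" for W
  proof (cases "c W = 0")
    case False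
    then have "effective (a - mdeg m - mdeg (lcm_mon W))" using c(1) by (simp add: graded_chain_def)
    from scale_graded_term[OF this, of 0 m "c W"] show ?thesis by simp
  qed simp
  then have "scale (xmon m) x = chain_sum U a c"
    by (simp add: x chain_sum_def scale_sum_right)
  moreover have "graded_chain U a c"
    unfolding graded_chain_def
  proof (intro allI impI conjI)
    fix W assume "c W \<noteq> 0"
    then have W: "W \<subseteq> U" "effective (a - mdeg m - mdeg (lcm_mon W))"
      using c(1) by (simp_all add: graded_chain_def)
    show "W \<subseteq> U" by (rule W)
    show "effective (a - mdeg (lcm_mon W))"
      unfolding effective_def
    proof
      fix j
      have "0 \<le> Poly_Mapping.lookup (a - mdeg m - mdeg (lcm_mon W)) j"
        using W(2) unfolding effective_def by blast
      then show "0 \<le> Poly_Mapping.lookup (a - mdeg (lcm_mon W)) j"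
        unfolding lookup_minus lookup_mdeg by linarith
    qed
  qed
  ultimately show ?thesis unfolding chains_def using c(2) by blast
qed

lemma chains_above_dimension:
  assumes "finite U" "card U < i"
  shows "chains U i a \<subseteq> {0}"
proof
  fix x assume "x \<in> chains U i a"
  then obtain c where x: "x = chain_sum U a c" and c: "\<And>W. c W \<noteq> 0 \<Longrightarrow> card W = i"
    unfolding chains_def by blast
  have "c W = 0" if "W \<in> Pow U" for W
    using c[of W] card_mono[of U W] assms that by fastforce
  then show "x \<in> {0}" by (simp add: x chain_sum_def)
qed

text \<open>
  In multidegree \<open>a\<close> the chains form the chain complex of the full simplex on the elements of \<open>U\<close>
  that divide the monomial \<open>x\<^sup>a\<close>. As soon as there is such an element, the least one
  serves as the apex of a cone.
\<close>

lemma chains_exact: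
  assumes U: "U \<in> scarf G" and z: "z \<in> chains U i a" "d z = 0"
    and vertex: "z \<noteq> 0 \<Longrightarrow> \<exists>v\<in>U. effective (a - mdeg v)"
  shows "\<exists>y\<in>chains U (Suc i) a. d y = z"
proof (cases "z = 0")
  case True
  then show ?thesis using chains_zero by (intro bexI[of _ 0]) auto
next
  case False
  obtain c where zc: "z = chain_sum U a c" and c: "graded_chain U a c"
    and card_c: "\<And>W. c W \<noteq> 0 \<Longrightarrow> card W = i"
    using z(1) unfolding chains_def by blast
  have fin: "finite U" and UG: "U \<subseteq> G" using U scarf_finite scarf_subset by auto
  let ?A = "{v \<in> U. effective (a - mdeg v)}"
  have "?A \<noteq> {}" "finite ?A" "?A \<subseteq> G" using vertex[OF False] fin UG by auto
  then obtain v where v: "v \<in> U" "effective (a - mdeg v)"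
    and least: "\<And>m. m \<in> ?A \<Longrightarrow> m = v \<or> (v, m) \<in> r"
    using strict_linear_order_least[OF order, of ?A] by auto
  have W_A: "W \<subseteq> ?A" "finite W" "effective a" if "c W \<noteq> 0" for W
  proof -
    have W: "W \<subseteq> U" "effective (a - mdeg (lcm_mon W))" using c that by (auto simp: graded_chain_def)
    show finW: "finite W" by (rule finite_subset[OF W(1) fin])
    show "W \<subseteq> ?A" "effective a" using W effective_diff_lcm[OF finW] by auto
  qed
  have "boundary r U c X = 0" for X
  proof (rule chain_sum_eq_0[OF U])
    show "graded_chain U a (boundary r U c)" by (rule graded_chain_boundary[OF fin c])
    show "chain_sum U a (boundary r U c) = 0" using z(2) d_chain_sum[OF U c] zc by simp
  qed
  then have bd0: "cone v (boundary r U c) W = 0" for W by (simp add: cone_def)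
  have hom: "boundary r U (cone v c) W + cone v (boundary r U c) W = c W" for W
  proof (rule cone_homotopy[OF fin v(1) order_props(1,2)])
    show "X \<subseteq> U \<and> (\<forall>m\<in>X. m = v \<or> (v, m) \<in> r)" if "c X \<noteq> 0" for X
      using W_A(1)[OF that] least by blast
  qed
  then have bd: "boundary r U (cone v c) = c" using bd0 by (intro ext) simp
  have cone_W: "v \<in> W" "c (W - {v}) \<noteq> 0" if "cone v c W \<noteq> 0" for W
    using that by (auto simp: cone_def split: if_splits)
  have gc: "graded_chain U a (cone v c)"
    unfolding graded_chain_def
  proof (intro allI impI conjI)
    fix W assume "cone v c W \<noteq> 0"
    note W = cone_W[OF this] and A = W_A[OF cone_W(2)[OF this]]
    show "W \<subseteq> U" using W A v(1) by blast
    have "finite W" using A(2) by simp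
    then show "effective (a - mdeg (lcm_mon W))"
      using A v(2) by (subst effective_diff_lcm) auto
  qed
  have "card W = Suc i" if "cone v c W \<noteq> 0" for W
  proof -
    have "finite W" using W_A(2)[OF cone_W(2)[OF that]] by simp
    then show ?thesis
      using card_c[OF cone_W(2)[OF that]] card_Suc_Diff1[OF _ cone_W(1)[OF that]] by simp
  qed
  then have "chain_sum U a (cone v c) \<in> chains U (Suc i) a"
    unfolding chains_def using gc by blast
  moreover have "d (chain_sum U a (cone v c)) = z"
    using d_chain_sum[OF U gc] bd zc by simp
  ultimately show ?thesis by blast
qed

text \<open>The base of the induction: \<open>H 0\<close> is generated by \<open>one\<close>, which is \<open>g {}\<close>.\<close>

lemma chains_zero_complete:
  assumes U: "U \<in> scarf G" and x: "x \<in> H 0" "x \<in> D a"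
  shows "x \<in> chains U 0 a"
proof -
  obtain s where s: "x = scale s one" using x H0_eq by blast
  have "x = component D a x" using component_mem[OF D_sum x(2), of a] by simp
  also have "\<dots> = (\<Sum>m\<in>Poly_Mapping.keys s. scale (Poly_Mapping.single m (Poly_Mapping.lookup s m))
      (component D (a - mdeg m) one))"
    unfolding s by (rule component_D_scale)
  also have "\<dots> \<in> chains U 0 a"
  proof (rule chains_sum)
    fix m
    show "scale (Poly_Mapping.single m (Poly_Mapping.lookup s m)) (component D (a - mdeg m) one)
        \<in> chains U 0 a"
    proof (cases "a = mdeg m")
      case True
      then show ?thesis
        using graded_term_chains[OF scarf_finite[OF U], of "{}" a "Poly_Mapping.lookup s m"]
        by (simp add: graded_term_def g_empty component_mem[OF D_sum one_D])
    qed (simp add: component_mem[OF D_sum one_D] chains_zero)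
  qed
  finally show ?thesis .
qed

text \<open>
  In homological degree 0 a chain is a multiple \<open>k x\<^sup>a\<close> of 1. If it is a nonzero boundary, then \<open>x\<^sup>a\<close>
  lies in \<open>I\<close> and is divisible by a generator. By the assumption on \<open>a\<close> this generator involves
  only variables of \<open>lcm_mon U\<close>; being squarefree, it divides \<open>lcm_mon U\<close>, which forces it
  into the Scarf simplex \<open>U\<close>.
\<close>

lemma boundary_vertex:
  assumes U: "U \<in> scarf G"
    and a: "\<And>j. Poly_Mapping.lookup (lcm_mon U) j = 0 \<Longrightarrow> Poly_Mapping.lookup a j \<le> 0"
    and z: "z \<in> chains U 0 a" "z \<in> d ` H 1" "z \<noteq> 0"
  shows "\<exists>v\<in>U. effective (a - mdeg v)"
proof -
  have fin: "finite U" by (rule scarf_finite[OF U])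
  obtain c where zc: "z = chain_sum U a c" and c: "graded_chain U a c"
    and card_c: "\<And>W. c W \<noteq> 0 \<Longrightarrow> card W = 0"
    using z(1) unfolding chains_def by blast
  have c0: "c W = 0" if "W \<in> Pow U" "W \<noteq> {}" for W
    using card_c[of W] that fin finite_subset[of W U] by auto
  have "z = (\<Sum>W\<in>{{}}. graded_term a W (c W))"
    unfolding zc chain_sum_def using fin c0 by (intro sum.mono_neutral_right) auto
  then have z0: "z = graded_term a {} (c {})" by simp
  with z(3) have "c {} \<noteq> 0" by auto
  with c have "effective (a - mdeg (lcm_mon {}))" unfolding graded_chain_def by blast
  then obtain b where b: "a = mdeg b" by (auto simp: effective_iff_mdeg)
  have "z = scale (Poly_Mapping.single b (c {})) one"
    by (simp add: z0 graded_term_def b g_empty)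
  then have "Poly_Mapping.single b (c {}) \<in> I" using z(2) augmentation by metis
  then have "Poly_Mapping.single b (c {}) \<in> ideal_gen (xmon ` G)"
    using generators by (simp add: minimal_monomial_generators_def)
  then obtain v where v: "v \<in> G" "divides v b"
    using monomial_ideal_keys[of "Poly_Mapping.single b (c {})" G b] \<open>c {} \<noteq> 0\<close> by auto
  have "divides v (lcm_mon U)"
    unfolding divides_def
  proof
    fix j
    have "Poly_Mapping.lookup v j \<le> Poly_Mapping.lookup b j" using v(2) by (simp add: divides_def)
    moreover have "Poly_Mapping.lookup v j \<le> 1"
      by (rule minimal_generators_squarefree[OF squarefree generators v(1)])
    ultimately show "Poly_Mapping.lookup v j \<le> Poly_Mapping.lookup (lcm_mon U) j"
      using a[of j] b by (cases "Poly_Mapping.lookup (lcm_mon U) j = 0") auto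
  qed
  then have "v \<in> U" using scarf_contains_divisors[OF finite_G U v(1)] by blast
  moreover have "effective (a - mdeg v)"
    using v(2) by (simp add: b effective_diff_mdeg divides_def)
  ultimately show ?thesis by blast
qed

text \<open>
  In the multidegrees supported on the variables of \<open>lcm_mon U\<close>,
  the basis elements indexed by the faces of \<open>U\<close> generate the whole resolution. The support
  condition, weaker than divisibility of \<open>lcm_mon U\<close>, is what products call for, since the degree
  of \<open>g W * g V\<close> is in general not squarefree. It is preserved by division by variables,
  so that the graded Nakayama lemma applies.
\<close>

theorem below_scarf_simplex:
  assumes U: "U \<in> scarf G"
    and a: "\<And>j. Poly_Mapping.lookup (lcm_mon U) j = 0 \<Longrightarrow> Poly_Mapping.lookup a j \<le> 0"
    and x: "x \<in> H i" "x \<in> D a"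
  shows "x \<in> chains U i a"
  using a x
proof (induction i arbitrary: a x)
  case 0
  then show ?case using chains_zero_complete[OF U] by blast
next
  case (Suc i)
  let ?ok = "\<lambda>a. \<forall>j. Poly_Mapping.lookup (lcm_mon U) j = 0 \<longrightarrow> Poly_Mapping.lookup a j \<le> (0::int)"
  show ?case
  proof (rule graded_nakayama[where ok = ?ok and N = "chains U (Suc i)" and i = "Suc i"])
    show "?ok (a - mdeg (Poly_Mapping.single j 1))" if "?ok a" for a j
    proof (intro allI impI)
      fix l assume "Poly_Mapping.lookup (lcm_mon U) l = 0"
      with that have "Poly_Mapping.lookup a l \<le> 0" by blast
      then show "Poly_Mapping.lookup (a - mdeg (Poly_Mapping.single j 1)) l \<le> 0"
        unfolding lookup_minus lookup_mdeg by linarith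
    qed
    show "\<exists>y\<in>chains U (Suc i) a. x - y \<in> range d"
      if ok: "?ok a" and x: "x \<in> H (Suc i)" "x \<in> D a" for a x
    proof -
      have z: "d x \<in> chains U i a"
        by (rule Suc.IH) (use ok d_H[OF x(1)] d_D[OF x(2)] in auto)
      \<comment> \<open>For \<open>i > 0\<close> a nonzero coefficient of \<open>d x\<close> sits at a nonempty face, which supplies \<open>v\<close>.\<close>
      have "\<exists>v\<in>U. effective (a - mdeg v)" if nz: "d x \<noteq> 0"
      proof (cases i)
        case 0
        have "d x \<in> d ` H 1" using x(1) 0 by simp
        then show ?thesis using boundary_vertex[OF U _ _ _ nz, of a] z ok 0 by auto
      next
        case (Suc i')
        obtain c where zc: "d x = chain_sum U a c" and c: "graded_chain U a c"
          and card_c: "\<And>W. c W \<noteq> 0 \<Longrightarrow> card W = i"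
          using z unfolding chains_def by blast
        obtain W where W: "c W \<noteq> 0"
          using nz zc by (cases "\<forall>W. c W = 0") (auto simp: chain_sum_def)
        then have W': "W \<subseteq> U" "effective (a - mdeg (lcm_mon W))" "card W = i"
          using c card_c by (auto simp: graded_chain_def)
        then obtain v where "v \<in> W" using Suc by fastforce
        moreover have "finite W" by (rule finite_subset[OF W'(1) scarf_finite[OF U]])
        ultimately show ?thesis using W' effective_diff_lcm by blast
      qed
      from chains_exact[OF U z d_d this] obtain y where
        y: "y \<in> chains U (Suc i) a" "d y = d x" by blast
      have mem: "x - y \<in> H (Suc i)" "x - y \<in> D a"
        using y(1) chains_subset[OF U, of "Suc i" a] x
          direct_sum_diff[OF H_sum] direct_sum_diff[OF D_sum] by blast+
      have "d (x - y) = 0" using y(2) by (simp add: d.diff)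
      from exact_homogeneous[OF mem this] obtain w where "d w = x - y" by blast
      then have "x - y \<in> range d" by (metis rangeI)
      with y(1) show ?thesis by blast
    qed
  qed (use Suc.prems chains_zero chains_add chains_scale chains_subset[OF U] in auto)
qed

corollary vanishing_below_scarf_simplex:
  assumes U: "U \<in> scarf G"
    and a: "\<And>j. Poly_Mapping.lookup (lcm_mon U) j = 0 \<Longrightarrow> Poly_Mapping.lookup a j \<le> 0"
    and x: "x \<in> H i" "x \<in> D a" and i: "card U < i"
  shows "x = 0"
  using below_scarf_simplex[OF U a x] chains_above_dimension[OF scarf_finite[OF U] i] by blast

end

section \<open>Products of Scarf elements\<close>

lemma sigma_split_left:
  assumes W: "finite W" "m \<in> W" and V: "finite V"
  shows "sigma r W V = sigma r (W - {m}) V + sigma1 r m V"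
proof -
  let ?S = "\<lambda>W. {(m, m'). m \<in> W \<and> m' \<in> V \<and> (m', m) \<in> r}"
  have "?S W = ?S (W - {m}) \<union> Pair m ` {m' \<in> V. (m', m) \<in> r}" using W(2) by auto
  moreover have "finite (?S (W - {m}))"
    by (rule finite_subset[of _ "W \<times> V"]) (use W V in auto)
  ultimately show ?thesis
    using V by (simp add: sigma_def sigma1_def card_Un_disjoint card_image inj_on_def disjoint_iff image_iff)
qed

lemma sigma_split_right:
  assumes V: "finite V" "m \<in> V" and W: "finite W"
  shows "sigma r W V = sigma r W (V - {m}) + card {w \<in> W. (m, w) \<in> r}"
proof -
  let ?S = "\<lambda>V. {(m, m'). m \<in> W \<and> m' \<in> V \<and> (m', m) \<in> r}"
  have "?S V = ?S (V - {m}) \<union> (\<lambda>w. (w, m)) ` {w \<in> W. (m, w) \<in> r}" using V(2) by auto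
  moreover have "finite (?S (V - {m}))"
    by (rule finite_subset[of _ "W \<times> V"]) (use W V in auto)
  ultimately show ?thesis
    using W by (simp add: sigma_def card_Un_disjoint card_image inj_on_def disjoint_iff image_iff)
qed

lemma sigma1_union:
  assumes "finite W" "finite V" "W \<inter> V = {}"
  shows "sigma1 r m (W \<union> V) = sigma1 r m W + sigma1 r m V"
proof -
  have "{m' \<in> W \<union> V. (m', m) \<in> r} = {m' \<in> W. (m', m) \<in> r} \<union> {m' \<in> V. (m', m) \<in> r}" by auto
  then show ?thesis
    using assms by (simp add: sigma1_def card_Un_disjoint disjoint_iff)
qed

text \<open>
  The sign rules \<open>sign_left\<close> and \<open>sign_right\<close> turn the two halves of the Leibniz rule for
  \<open>g\<^sub>W * g\<^sub>V\<close> into the boundary of \<open>W \<union> V\<close>. On the left, the inversions between \<open>m\<close> and \<open>V\<close>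
  occur twice and cancel; on the right, the elements of \<open>W\<close> before and after \<open>m\<close> add up to the sign
  \<open>(-1)\<^bsup>|W|\<^esup>\<close> of the Leibniz rule.
\<close>

lemma sign_left:
  assumes "finite W" "finite V" "W \<inter> V = {}" "m \<in> W"
  shows "(-1 :: 'k::comm_ring_1) ^ (sigma1 r m (W \<union> V) + sigma r W V) =
    (-1) ^ (sigma1 r m W + sigma r (W - {m}) V)"
proof -
  have "sigma1 r m (W \<union> V) + sigma r W V =
      sigma1 r m W + sigma r (W - {m}) V + 2 * sigma1 r m V"
    using sigma1_union[OF assms(1-3)] sigma_split_left[OF assms(1,4,2)] by simp
  then show ?thesis by (simp add: power_add)
qed

lemma sign_right:
  assumes "finite W" "finite V" "W \<inter> V = {}" "m \<in> V"
    and r: "irrefl r" "trans r" "total_on (W \<union> V) r"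
  shows "sigma1 r m (W \<union> V) + sigma r W V = card W + sigma1 r m V + sigma r W (V - {m})"
proof -
  have "(w, m) \<in> r \<or> (m, w) \<in> r" if "w \<in> W" for w
    using r(3) assms(3,4) that unfolding total_on_def by (metis UnCI disjoint_iff)
  then have "W = {w \<in> W. (w, m) \<in> r} \<union> {w \<in> W. (m, w) \<in> r}" by blast
  then have "card W = card ({w \<in> W. (w, m) \<in> r} \<union> {w \<in> W. (m, w) \<in> r})" by (rule arg_cong)
  also have "\<dots> = card {w \<in> W. (w, m) \<in> r} + card {w \<in> W. (m, w) \<in> r}"
  proof (rule card_Un_disjoint)
    have "(w, m) \<notin> r \<or> (m, w) \<notin> r" for w using r(1,2) by (metis irreflD transD)
    then show "{w \<in> W. (w, m) \<in> r} \<inter> {w \<in> W. (m, w) \<in> r} = {}" by blast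
  qed (use assms(1) in auto)
  finally have "card W = sigma1 r m W + card {w \<in> W. (m, w) \<in> r}"
    by (simp only: sigma1_def)
  then show ?thesis
    using sigma1_union[OF assms(1-3)] sigma_split_right[OF assms(2,4,1)] by simp
qed

context scarf_resolution
begin

context
  fixes mult :: "'f \<Rightarrow> 'f \<Rightarrow> 'f"
  assumes mult: "multiplication scale H D d one mult"
begin

lemma mult_homs: "\<forall>x. module_hom scale scale (\<lambda>y. mult x y)" "\<forall>y. module_hom scale scale (\<lambda>x. mult x y)"
  using mult unfolding multiplication_def by - (elim conjE; assumption)+

lemma mult_scaled_sum:
  "mult x (\<Sum>j\<in>J. scale (s j) (y j)) = (\<Sum>j\<in>J. scale (s j) (mult x (y j)))"
  "mult (\<Sum>j\<in>J. scale (s j) (y j)) x = (\<Sum>j\<in>J. scale (s j) (mult (y j) x))"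
proof -
  interpret l: module_hom scale scale "\<lambda>y. mult x y" by (rule mult_homs(1)[rule_format])
  interpret r: module_hom scale scale "\<lambda>y. mult y x" by (rule mult_homs(2)[rule_format])
  show "mult x (\<Sum>j\<in>J. scale (s j) (y j)) = (\<Sum>j\<in>J. scale (s j) (mult x (y j)))"
    by (simp only: l.sum l.scale)
  show "mult (\<Sum>j\<in>J. scale (s j) (y j)) x = (\<Sum>j\<in>J. scale (s j) (mult (y j) x))"
    by (simp only: r.sum r.scale)
qed

lemma mult_rules:
  "\<forall>a b. \<forall>x\<in>D a. \<forall>y\<in>D b. mult x y \<in> D (a + b)"
  "\<forall>x. mult one x = x \<and> mult x one = x"
  "\<forall>i j. \<forall>x\<in>H i. \<forall>y\<in>H j.
     d (mult x y) = mult (d x) y + scale ((-1) ^ i) (mult x (d y)) \<and>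
     mult x y \<in> H (i + j) \<and>
     mult x y = scale ((-1) ^ (i * j)) (mult y x)"
  using mult unfolding multiplication_def by - (elim conjE; assumption)+

lemma mult_D: "x \<in> D a \<Longrightarrow> y \<in> D b \<Longrightarrow> mult x y \<in> D (a + b)"
  using mult_rules(1) by blast

lemma mult_one: "mult one x = x"
  using mult_rules(2) by blast

lemma mult_H: "x \<in> H i \<Longrightarrow> y \<in> H j \<Longrightarrow> mult x y \<in> H (i + j)"
  using mult_rules(3) by blast

lemma mult_leibniz:
  "x \<in> H i \<Longrightarrow> y \<in> H j \<Longrightarrow> d (mult x y) = mult (d x) y + scale ((-1) ^ i) (mult x (d y))"
  using mult_rules(3) by blast

text \<open>
  The product lies in a multidegree that involves only the variables of \<open>lcm_mon (W \<union> V)\<close>, where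
  the resolution vanishes above homological degree \<open>card (W \<union> V)\<close>. If \<open>W\<close> and \<open>V\<close> meet, the
  product itself is in that range. Otherwise, in the bidegree of the product there are no nonzero
  boundaries, hence (unless \<open>W\<close> and \<open>V\<close> are empty) no nonzero cycles, and the product is determined
  by its own boundary, which the Leibniz rule and the induction hypothesis provide.
\<close>

lemma mult_g:
  assumes "W \<in> scarf G" "V \<in> scarf G" "W \<union> V \<in> scarf G"
  shows "mult (g W) (g V) = (if W \<inter> V = {}
    then graded_term (mdeg (lcm_mon W) + mdeg (lcm_mon V)) (W \<union> V) ((-1) ^ sigma r W V) else 0)"
  using assms
proof (induction "card W + card V" arbitrary: W V rule: less_induct)
  case less
  let ?U = "W \<union> V" and ?a = "mdeg (lcm_mon W) + mdeg (lcm_mon V)"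
  note W = less.prems(1) and V = less.prems(2) and U = less.prems(3)
  have fin: "finite W" "finite V" "finite ?U" using W V U scarf_finite by auto
  have prod: "mult (g W) (g V) \<in> H (card W + card V)" "mult (g W) (g V) \<in> D ?a"
    by (intro mult_H mult_D g_mem W V)+
  have supp: "Poly_Mapping.lookup ?a j \<le> 0" if "Poly_Mapping.lookup (lcm_mon ?U) j = 0" for j
  proof -
    have "divides (lcm_mon W) (lcm_mon ?U)" "divides (lcm_mon V) (lcm_mon ?U)"
      using fin by (intro lcm_mon_mono; blast)+
    then have "Poly_Mapping.lookup (lcm_mon W) j \<le> 0" "Poly_Mapping.lookup (lcm_mon V) j \<le> 0"
      unfolding divides_def that[symmetric] by blast+
    then show ?thesis by (simp add: lookup_add)
  qed
  have eff: "effective (mdeg (lcm_mon X) + mdeg (lcm_mon Y) - mdeg (lcm_mon (X \<union> Y)))"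
    if "finite X" "finite Y" for X Y
  proof -
    show ?thesis
      using lcm_union_divides[OF that] by (simp add: effective_diff_mdeg divides_def flip: mdeg_add)
  qed
  show ?case
  proof (cases "W \<inter> V = {}")
    case False
    then have "card ?U < card W + card V"
      using card_Un_Int[OF fin(1,2)] fin by (simp add: card_gt_0_iff)
    from vanishing_below_scarf_simplex[OF U supp prod this] show ?thesis using False by simp
  next
    case True
    have card_U: "card ?U = card W + card V" using card_Un_disjoint[OF fin(1,2) True] .
    let ?c = "graded_term ?a ?U ((-1) ^ sigma r W V)"
    let ?w = "mult (g W) (g V) - ?c"
    have mem: "?w \<in> H (card ?U)" "?w \<in> D ?a"
      using prod graded_term_mem[OF U] direct_sum_diff[OF H_sum] direct_sum_diff[OF D_sum]
      by (simp_all add: card_U)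
    have "?w = 0"
    proof (cases "?U = {}")
      case True
      moreover have "monomial_of 0 1 = (1 :: ('n, 'k) pring)"
        using monomial_of_mdeg[of 0 1] by simp
      ultimately show ?thesis by (simp add: g_empty mult_one graded_term_def sigma_def)
    next
      case False
      let ?t = "\<lambda>m. graded_term ?a (?U - {m}) ((-1) ^ (sigma1 r m ?U + sigma r W V))"
      have "d ?c = (\<Sum>m\<in>?U. ?t m)"
        using d_graded_term[OF U eff[OF fin(1,2)]] by (simp add: power_add)
      also have "\<dots> = (\<Sum>m\<in>W. ?t m) + (\<Sum>m\<in>V. ?t m)"
        by (rule sum.union_disjoint[OF fin(1,2) True])
      also have "(\<Sum>m\<in>W. ?t m) = mult (d (g W)) (g V)"
        unfolding d_g[OF W] mult_scaled_sum
      proof (intro sum.cong refl)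
        fix m assume m: "m \<in> W"
        let ?X = "W - {m}" and ?q = "lcm_mon W - lcm_mon (W - {m})"
        have sets: "?X \<union> V = ?U - {m}" "?X \<inter> V = {}" using m True by auto
        have "?X \<in> scarf G" by (rule scarf_face[OF finite_G W]) auto
        moreover have "?X \<union> V \<in> scarf G" by (rule scarf_face[OF finite_G U]) auto
        moreover have "card ?X < card W" by (rule card_Diff1_less[OF fin(1) m])
        ultimately have IH: "mult (g ?X) (g V) = graded_term (mdeg (lcm_mon ?X) + mdeg (lcm_mon V))
            (?U - {m}) ((-1) ^ sigma r ?X V)"
          using less.hyps[of ?X V] V sets by simp
        have "mdeg ?q = mdeg (lcm_mon W) - mdeg (lcm_mon ?X)"
          using fin by (intro mdeg_diff lcm_mon_mono) auto
        then have a: "mdeg (lcm_mon ?X) + mdeg (lcm_mon V) + mdeg ?q = ?a" by simp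
        have "effective (mdeg (lcm_mon ?X) + mdeg (lcm_mon V) - mdeg (lcm_mon (?U - {m})))"
          using eff[of ?X V] fin sets by simp
        from scale_graded_term[OF this, of "sigma1 r m W" ?q "(-1) ^ sigma r ?X V"]
        show "?t m = scale ((-1) ^ sigma1 r m W * xmon ?q) (mult (g ?X) (g V))"
          unfolding IH a sign_left[OF fin(1,2) True m] by (simp add: power_add)
      qed
      also have "(\<Sum>m\<in>V. ?t m) = scale ((-1) ^ card W) (mult (g W) (d (g V)))"
        unfolding d_g[OF V] mult_scaled_sum scale_sum_right
      proof (intro sum.cong refl)
        fix m assume m: "m \<in> V"
        let ?X = "V - {m}" and ?q = "lcm_mon V - lcm_mon (V - {m})"
        have sets: "W \<union> ?X = ?U - {m}" "W \<inter> ?X = {}" using m True by auto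
        have "?X \<in> scarf G" by (rule scarf_face[OF finite_G V]) auto
        moreover have "W \<union> ?X \<in> scarf G" by (rule scarf_face[OF finite_G U]) auto
        moreover have "card ?X < card V" by (rule card_Diff1_less[OF fin(2) m])
        ultimately have IH: "mult (g W) (g ?X) = graded_term (mdeg (lcm_mon W) + mdeg (lcm_mon ?X))
            (?U - {m}) ((-1) ^ sigma r W ?X)"
          using less.hyps[of W ?X] W sets by simp
        have "mdeg ?q = mdeg (lcm_mon V) - mdeg (lcm_mon ?X)"
          using fin by (intro mdeg_diff lcm_mon_mono) auto
        then have a: "mdeg (lcm_mon W) + mdeg (lcm_mon ?X) + mdeg ?q = ?a" by simp
        have total: "total_on ?U r"
          using order_props(3) scarf_subset[OF U] unfolding total_on_def by blast
        have "effective (mdeg (lcm_mon W) + mdeg (lcm_mon ?X) - mdeg (lcm_mon (?U - {m})))"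
          using eff[of W ?X] fin sets by simp
        from scale_graded_term[OF this, of "card W + sigma1 r m V" ?q "(-1) ^ sigma r W ?X"]
        show "?t m = scale ((-1) ^ card W)
            (scale ((-1) ^ sigma1 r m V * xmon ?q) (mult (g W) (g ?X)))"
          unfolding IH a sign_right[OF fin(1,2) True m order_props(1,2) total]
          by (simp add: power_add mult.assoc)
      qed
      also have "mult (d (g W)) (g V) + scale ((-1) ^ card W) (mult (g W) (d (g V))) =
          d (mult (g W) (g V))"
        using mult_leibniz[OF g_mem(1)[OF W] g_mem(1)[OF V]] by simp
      finally have dw: "d ?w = 0" by (simp add: d.diff)
      obtain k where k: "card ?U = Suc k"
        using False fin by (metis card_eq_0_iff not0_implies_Suc)
      from exact_homogeneous[OF mem[unfolded k] dw] obtain y where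
        y: "y \<in> H (Suc (Suc k))" "y \<in> D ?a" "d y = ?w" by blast
      from vanishing_below_scarf_simplex[OF U supp y(1,2)] k have "y = 0" by simp
      then show ?thesis using y(3) by simp
    qed
    then show ?thesis using True by simp
  qed
qed

lemma mult_taylor_basis:
  assumes "W \<in> scarf G" "V \<in> scarf G" "W \<union> V \<in> scarf G"
  shows "mult (\<phi> (taylor_basis W)) (\<phi> (taylor_basis V)) =
    (if W \<inter> V = {}
     then scale ((-1) ^ sigma r W V * xmon (lcm_mon W + lcm_mon V - lcm_mon (W \<union> V)))
            (\<phi> (taylor_basis (W \<union> V)))
     else 0)"
proof -
  have fin: "finite W" "finite V" using assms scarf_finite by auto
  from mdeg_diff[OF lcm_union_divides[OF fin]]
  have "mdeg (lcm_mon W) + mdeg (lcm_mon V) - mdeg (lcm_mon (W \<union> V)) =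
      mdeg (lcm_mon W + lcm_mon V - lcm_mon (W \<union> V))"
    by (simp add: mdeg_add)
  then show ?thesis
    using mult_g[OF assms]
    by (simp add: g_def graded_term_def minus_one_power_single xmon_def mult_single)
qed

end

end

theorem proposition3p1:
  fixes I :: "('n::finite, 'k::field) pring set"
    and G :: "'n expo set"
    and r :: "'n expo rel"
    and scale :: "('n, 'k) pring \<Rightarrow> 'f::ab_group_add \<Rightarrow> 'f"
    and H :: "nat \<Rightarrow> 'f set"
    and D :: "('n \<Rightarrow>\<^sub>0 int) \<Rightarrow> 'f set"
    and d :: "'f \<Rightarrow> 'f"
    and one :: 'f
    and mult :: "'f \<Rightarrow> 'f \<Rightarrow> 'f"
    and \<phi> :: "('n, 'k) taylor \<Rightarrow> 'f"
    and V W :: "'n expo set"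
  assumes "squarefree_monomial_ideal I" and "I \<noteq> UNIV"
    and "minimal_monomial_generators I G"
    and "strict_linear_order_on G r"
    and "minimal_free_resolution I scale H D d one"
    and "scarf_embedding G r scale H D d one \<phi>"
    and "multiplication scale H D d one mult"
    and "V \<in> scarf G" and "W \<in> scarf G" and "V \<union> W \<in> scarf G"
  shows "mult (\<phi> (taylor_basis W)) (\<phi> (taylor_basis V)) =
           (if W \<inter> V = {}
            then scale ((-1) ^ sigma r W V * xmon (lcm_mon W + lcm_mon V - lcm_mon (W \<union> V)))
                   (\<phi> (taylor_basis (W \<union> V)))
            else 0) \<and>
         (\<forall>mult'. multiplication scale H D d one mult' \<longrightarrow>
            mult' (\<phi> (taylor_basis W)) (\<phi> (taylor_basis V)) =
            mult (\<phi> (taylor_basis W)) (\<phi> (taylor_basis V)))"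
proof -
  interpret scarf_resolution I scale H D d one G r \<phi>
    by unfold_locales (use assms in auto)
  have "W \<union> V \<in> scarf G" using assms(10) by (simp add: Un_commute)
  note product = mult_taylor_basis[OF _ assms(9,8) this]
  show ?thesis using product product[OF assms(7)] by simp
qed

end
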